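(* As meromorphic functions in $(x,z)\in\mathbb{C}\times\mathbb{C}$, the $c$-function satisfies $$c(x,z)c^d(z,-x)c^d(-z,-x)+c(-x,z)c^d(z,x)c^d(-z,-x)=c(x,z)c(-x,z)c^d(-z,-x)+c(x,z)c(-x,-z)c^d(z,-x).$$
   Context: Fix $\tau\in\sqrt{-1}\,\mathbb{R}_{>0}$, put $q^x:=e^{2\pi\sqrt{-1}\tau x}$ for $x\in\mathbb{C}$, so $0<q=e^{2\pi\sqrt{-1}\tau}<1$. Fix a step-size $s\in\mathbb{Q}_{>0}$ and real Hecke parameters $\kappa,\lambda,\upsilon,\varsigma$. Askey--Wilson parameters: $a_s=q^{\kappa+\lambda}$, $b_s=-q^{\kappa-\lambda}$, $c_s=q^{\frac{s}{2}+\upsilon+\varsigma}$, $d_s=-q^{\frac{s}{2}+\upsilon-\varsigma}$. Dual Askey--Wilson parameters ($\lambda$ and $\upsilon$ interchanged): $\widetilde a_s=q^{\kappa+\upsilon}$, $\widetilde b_s=-q^{\kappa-\upsilon}$, $\widetilde c_s=q^{\frac{s}{2}+\lambda+\varsigma}$, $\widetilde d_s=-q^{\frac{s}{2}+\lambda-\varsigma}$. Theta functions: $(u;p)_\infty=\prod_{i\geq 0}(1-up^i)$, $\theta(u;p)=(u;p)_\infty(p/u;p)_\infty$, $\theta(u_1,\ldots,u_r;p)=\prod_{i=1}^r\theta(u_i;p)$. $W(x,z)=q^{(\kappa+\lambda+x)(\kappa+\upsilon+z)/s}$. The normalized $c$-function is $$c(x,z)=c(x,z;\kappa,\lambda,\upsilon,\varsigma;q,s)=\frac{\theta\bigl(\widetilde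 a_sq^{-z},\widetilde b_sq^{-z},\widetilde c_sq^{-z},\frac{d_sq^{x-z}}{\widetilde a_s};q^s\bigr)}{W(x,z)\,\theta\bigl(q^{-2z},d_sq^x;q^s\bigr)},$$ and $c^d(x,z)=c(x,z;\kappa,\upsilon,\lambda,\varsigma;q,s)$ is the $c$-function with $\lambda$ and $\upsilon$ interchanged (so all Askey--Wilson parameters and their duals are interchanged, also in $W$). *)

theory Defs
  imports "HOL-Analysis.Analysis"
begin

text \<open>
  Holomorphy in two complex variables: the real Frechet derivative exists and is
  complex linear.
\<close>

definition holomorphic2_on :: "(complex \<times> complex \<Rightarrow> complex) \<Rightarrow> (complex \<times> complex) set \<Rightarrow> bool"
  where "holomorphic2_on f U \<longleftrightarrow>
    (\<forall>p\<in>U. \<exists>a b. (f has_derivative (\<lambda>(u, v). a * u + b * v)) (at p))"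

text \<open>
  A meromorphic function is represented by a total function that is locally a quotient of
  holomorphic functions whose denominator does not vanish identically on any nonempty open
  set.  The values of the representative on the zero set of the denominator are irrelevant.
\<close>

definition meromorphic2 :: "(complex \<times> complex \<Rightarrow> complex) \<Rightarrow> bool"
  where "meromorphic2 f \<longleftrightarrow>
    (\<forall>p. \<exists>U g h. open U \<and> p \<in> U \<and> holomorphic2_on g U \<and> holomorphic2_on h U \<and>
       (\<forall>V. open V \<and> V \<noteq> {} \<and> V \<subseteq> U \<longrightarrow> (\<exists>v\<in>V. h v \<noteq> 0)) \<and>
       (\<forall>v\<in>U. h v \<noteq> 0 \<longrightarrow> f v = g v / h v))"

text \<open>
  Two representatives define the same meromorphic function iff they agree off a nowhere
  dense set.
\<close>

definition eq_meromorphic2 ::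
    "(complex \<times> complex \<Rightarrow> complex) \<Rightarrow> (complex \<times> complex \<Rightarrow> complex) \<Rightarrow> bool"
  where "eq_meromorphic2 f g \<longleftrightarrow>
    meromorphic2 f \<and> meromorphic2 g \<and> interior (closure {p. f p \<noteq> g p}) = {}"

text \<open>\<open>qpow \<tau> x\<close> is $q^x$ for $q = e^{2\pi i\tau}$.\<close>

definition qpow :: "complex \<Rightarrow> complex \<Rightarrow> complex"
  where "qpow \<tau> x = exp (2 * of_real pi * \<i> * \<tau> * x)"

definition qpoch :: "complex \<Rightarrow> complex \<Rightarrow> complex"
  where "qpoch u p = (\<Prod>i. 1 - u * p ^ i)"

definition theta :: "complex \<Rightarrow> complex \<Rightarrow> complex"
  where "theta u p = qpoch u p * qpoch (p / u) p"

definition thetas :: "complex list \<Rightarrow> complex \<Rightarrow> complex"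
  where "thetas us p = (\<Prod>u\<leftarrow>us. theta u p)"

text \<open>
  The Askey--Wilson parameters.  The dual ones are obtained by exchanging the arguments
  \<open>lam\<close> (for $\lambda$) and \<open>\<upsilon>\<close>.  The argument \<open>\<sigma>\<close> stands for $\varsigma$.
\<close>

definition AW_a :: "complex \<Rightarrow> real \<Rightarrow> real \<Rightarrow> real \<Rightarrow> real \<Rightarrow> real \<Rightarrow> complex"
  where "AW_a \<tau> s \<kappa> lam \<upsilon> \<sigma> = qpow \<tau> (of_real (\<kappa> + lam))"

definition AW_b :: "complex \<Rightarrow> real \<Rightarrow> real \<Rightarrow> real \<Rightarrow> real \<Rightarrow> real \<Rightarrow> complex"
  where "AW_b \<tau> s \<kappa> lam \<upsilon> \<sigma> = - qpow \<tau> (of_real (\<kappa> - lam))"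

definition AW_c :: "complex \<Rightarrow> real \<Rightarrow> real \<Rightarrow> real \<Rightarrow> real \<Rightarrow> real \<Rightarrow> complex"
  where "AW_c \<tau> s \<kappa> lam \<upsilon> \<sigma> = qpow \<tau> (of_real (s / 2 + \<upsilon> + \<sigma>))"

definition AW_d :: "complex \<Rightarrow> real \<Rightarrow> real \<Rightarrow> real \<Rightarrow> real \<Rightarrow> real \<Rightarrow> complex"
  where "AW_d \<tau> s \<kappa> lam \<upsilon> \<sigma> = - qpow \<tau> (of_real (s / 2 + \<upsilon> - \<sigma>))"

definition gauge_W ::
    "complex \<Rightarrow> real \<Rightarrow> real \<Rightarrow> real \<Rightarrow> real \<Rightarrow> real \<Rightarrow> complex \<Rightarrow> complex \<Rightarrow> complex"
  where "gauge_W \<tau> s \<kappa> lam \<upsilon> \<sigma> x z =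
    qpow \<tau> ((of_real \<kappa> + of_real lam + x) * (of_real \<kappa> + of_real \<upsilon> + z) / of_real s)"

definition c_fun ::
    "complex \<Rightarrow> real \<Rightarrow> real \<Rightarrow> real \<Rightarrow> real \<Rightarrow> real \<Rightarrow> complex \<Rightarrow> complex \<Rightarrow> complex"
  where "c_fun \<tau> s \<kappa> lam \<upsilon> \<sigma> x z =
    (let p = qpow \<tau> (of_real s);
         d = AW_d \<tau> s \<kappa> lam \<upsilon> \<sigma>;
         a' = AW_a \<tau> s \<kappa> \<upsilon> lam \<sigma>;
         b' = AW_b \<tau> s \<kappa> \<upsilon> lam \<sigma>;
         c' = AW_c \<tau> s \<kappa> \<upsilon> lam \<sigma>
     in thetas [a' * qpow \<tau> (- z), b' * qpow \<tau> (- z), c' * qpow \<tau> (- z),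
                d * qpow \<tau> (x - z) / a'] p /
        (gauge_W \<tau> s \<kappa> lam \<upsilon> \<sigma> x z * thetas [qpow \<tau> (- 2 * z), d * qpow \<tau> x] p))"

definition cd_fun ::
    "complex \<Rightarrow> real \<Rightarrow> real \<Rightarrow> real \<Rightarrow> real \<Rightarrow> real \<Rightarrow> complex \<Rightarrow> complex \<Rightarrow> complex"
  where "cd_fun \<tau> s \<kappa> lam \<upsilon> \<sigma> x z = c_fun \<tau> s \<kappa> \<upsilon> lam \<sigma> x z"

end

theory Submission
  imports Defs "HOL-Complex_Analysis.Complex_Analysis"
begin

text \<open>
  Put \<open>p = q\<^sup>s\<close>, \<open>X = q\<^sup>x\<close>, \<open>Z = q\<^sup>z\<close>
  and write \<open>\<theta>(u)\<close> for \<open>\<theta>(u; p)\<close>. The gauge factor is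
  the same when \<open>\<lambda>\<close> and \<open>\<upsilon>\<close> are exchanged together
  with its two arguments, so every one of the four products carries the factor \<open>1 /
  (W(x,z) W(-x,z) W(-x,-z))\<close>, which cancels. The quotients \<open>d/a'\<close> and
  \<open>d'/a\<close>, a prime marking a dual parameter, have the same value \<open>e\<close>.
  After clearing denominators and a common factor, the claim is an identity between products of
  theta functions (\<open>theta_products_identity\<close>, \<open>c_function_algebra\<close>):
  the function \<open>F(X) = \<theta>(e X/Z) \<theta>(e X Z) Q(X) / \<theta>(X\<^sup>2)\<close>
  with \<open>Q(X) = \<theta>(aX) \<theta>(bX) \<theta>(cX) \<theta>(pX/d)\<close>, made even in
  \<open>X\<close> by adding \<open>F(1/X)\<close>, equals the analogous function obtained by
  exchanging the roles of \<open>X\<close> and \<open>Z\<close> and replacing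
  \<open>Q(X)\<close> by \<open>Q(e/Z)\<close>. The identity holds because the product of the
  four parameters of \<open>Q\<close> with \<open>e\<^sup>2\<close> is \<open>p\<^sup>2\<close>.

  To prove it, regard the difference of the two sides, multiplied by \<open>\<theta>(X\<^sup>2)
  \<theta>(Z\<^sup>2)\<close>, as a function of \<open>Z\<close>; this is \<open>defect\<close>.
  It is quasi-periodic of degree 6 under \<open>Z \<mapsto> pZ\<close>, and it is odd up to a
  monomial under \<open>Z \<mapsto> 1/Z\<close>. Oddness forces it to vanish where
  \<open>Z\<^sup>2\<close> is a power of \<open>p\<close>, so \<open>\<theta>(Z\<^sup>2)\<close>
  divides it and a function of degree 2 remains. For \<open>Z = e X\<close> all terms collapse,
  because in each of the two sides one of the terms contains \<open>\<theta>(1) = 0\<close> and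
  in the others the values \<open>Q(1/X)\<close> and \<open>Q(e/Z)\<close> coincide; by the
  symmetries in \<open>X\<close> and \<open>Z\<close> the points \<open>e/X\<close> and
  \<open>1/(e X)\<close> are zeros as well. A theta function of degree 2 with three zeros that
  are inequivalent modulo powers of \<open>p\<close> vanishes (\<open>theta_fun_eq_0\<close>).
  The three zeros are inequivalent only for generic \<open>e\<close> and \<open>X\<close>; the
  exceptional values are reached by continuity (\<open>defect_theta4\<close>).

  The zero count itself is Liouville's theorem: dividing by one theta factor per zero leaves a
  holomorphic function of degree -1 on the punctured plane, and in the coordinate \<open>log
  Z\<close> such a function is bounded and not constant unless it is 0.

  For the statement about meromorphic functions, all functions involved are quotients of
  functions holomorphic on the whole of \<open>\<complex>\<^sup>2\<close>, and their
  denominators vanish on nowhere dense sets only.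
\<close>

section \<open>The theta function\<close>

locale nome =
  fixes p :: complex
  assumes nz: "p \<noteq> 0" and norm_less_1: "norm p < 1"
begin

lemma convergent_prod_qpoch: "convergent_prod (\<lambda>i. 1 - u * p ^ i)"
proof -
  have "summable (\<lambda>i. norm u * norm p ^ i)"
    using norm_less_1 by (intro summable_mult summable_geometric) auto
  hence "summable (\<lambda>i. norm ((1 - u * p ^ i) - 1))"
    by (simp add: norm_mult norm_power)
  thus ?thesis
    by (intro abs_convergent_prod_imp_convergent_prod) (simp add: abs_convergent_prod_conv_summable)
qed

lemma has_prod_qpoch: "(\<lambda>i. 1 - u * p ^ i) has_prod qpoch u p"
  unfolding qpoch_def using convergent_prod_qpoch by (rule convergent_prod_has_prod)

lemma LIMSEQ_qpoch: "(\<lambda>n. \<Prod>i<n. 1 - u * p ^ i) \<longlonglongrightarrow> qpoch u p"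
  by (rule has_prod_imp_tendsto'[OF has_prod_qpoch])

lemma qpoch_eq_0_iff: "qpoch u p = 0 \<longleftrightarrow> (\<exists>i. u * p ^ i = 1)"
  using has_prod_eq_0_iff[OF has_prod_qpoch, of u] by (auto simp: image_iff)

lemma qpoch_split: "qpoch u p = (1 - u) * qpoch (u * p) p"
proof (rule LIMSEQ_unique)
  show "(\<lambda>n. \<Prod>i<Suc n. 1 - u * p ^ i) \<longlonglongrightarrow> qpoch u p"
    using LIMSEQ_qpoch by (rule LIMSEQ_Suc)
  have "(\<lambda>n. \<Prod>i<Suc n. 1 - u * p ^ i) = (\<lambda>n. (1 - u) * (\<Prod>i<n. 1 - u * p * p ^ i))"
    by (subst prod.lessThan_Suc_shift) (simp add: mult.assoc)
  thus "(\<lambda>n. \<Prod>i<Suc n. 1 - u * p ^ i) \<longlonglongrightarrow> (1 - u) * qpoch (u * p) p"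
    by (simp only:) (intro tendsto_intros LIMSEQ_qpoch)
qed

lemma uniform_limit_qpoch:
  "uniform_limit (cball 0 R) (\<lambda>n u. \<Prod>i<n. 1 - u * p ^ i) (\<lambda>u. qpoch u p) sequentially"
proof -
  have "uniformly_convergent_on (cball 0 R) (\<lambda>n u. \<Prod>i<n. 1 - u * p ^ i)"
  proof (rule Infinite_Products.uniformly_convergent_on_prod')
    have sm: "summable (\<lambda>i. R * norm p ^ i)"
      using norm_less_1 by (intro summable_mult summable_geometric) auto
    show "uniformly_convergent_on (cball 0 R) (\<lambda>N u. \<Sum>n<N. norm (1 - u * p ^ n - 1))"
    proof (rule Weierstrass_m_test'[OF _ sm])
      fix n and u :: complex
      assume "u \<in> cball 0 R"
      thus "norm (norm (1 - u * p ^ n - 1)) \<le> R * norm p ^ n"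
        by (simp add: norm_mult norm_power mult_right_mono)
    qed
  qed (auto intro!: continuous_intros)
  then obtain g where g: "uniform_limit (cball 0 R) (\<lambda>n u. \<Prod>i<n. 1 - u * p ^ i) g sequentially"
    by (auto simp: uniformly_convergent_on_def)
  have "g u = qpoch u p" if "u \<in> cball 0 R" for u
    using LIMSEQ_unique[OF tendsto_uniform_limitI[OF g that] LIMSEQ_qpoch] .
  thus ?thesis
    using g by (metis (mono_tags, lifting) uniform_limit_cong')
qed

lemma holomorphic_qpoch: "(\<lambda>u. qpoch u p) holomorphic_on UNIV"
proof (rule holomorphic_uniform_sequence)
  fix z :: complex
  have "uniform_limit (cball z 1) (\<lambda>n u. \<Prod>i<n. 1 - u * p ^ i) (\<lambda>u. qpoch u p) sequentially"
    by (rule uniform_limit_on_subset[OF uniform_limit_qpoch[of "norm z + 1"]])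
      (simp add: cball_subset_cball_iff)
  thus "\<exists>d>0. cball z d \<subseteq> UNIV \<and>
      uniform_limit (cball z d) (\<lambda>n u. \<Prod>i<n. 1 - u * p ^ i) (\<lambda>u. qpoch u p) sequentially"
    by (intro exI[of _ 1]) auto
qed (auto intro!: holomorphic_intros)

abbreviation \<theta> :: "complex \<Rightarrow> complex"
  where "\<theta> u \<equiv> theta u p"

lemma holomorphic_theta: "\<theta> holomorphic_on - {0}"
proof -
  have "(\<lambda>u. qpoch u p) \<circ> (\<lambda>u. p / u) holomorphic_on - {0}"
    by (rule holomorphic_on_compose_gen[OF _ holomorphic_qpoch]) (auto intro!: holomorphic_intros)
  thus ?thesis
    unfolding theta_def o_def
    by (intro holomorphic_intros holomorphic_on_subset[OF holomorphic_qpoch]) auto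
qed

lemma holomorphic_theta_compose:
  assumes "f holomorphic_on A" "\<And>z. z \<in> A \<Longrightarrow> f z \<noteq> 0"
  shows "(\<lambda>z. \<theta> (f z)) holomorphic_on A"
proof -
  have "f ` A \<subseteq> - {0}" using assms(2) by auto
  thus ?thesis
    using holomorphic_on_compose_gen[OF assms(1) holomorphic_theta] by (simp add: o_def)
qed

lemma theta_reflect: "\<theta> (p / u) = \<theta> u"
  using nz by (simp add: theta_def mult.commute)

text \<open>
  Passing from \<open>u\<close> to \<open>p u\<close> removes the factor \<open>1 - u\<close> from one of the two products and adds
  \<open>1 - 1/u\<close> to the other; the ratio of these is \<open>-1/u\<close>.
\<close>

lemma theta_mult_p:
  assumes "u \<noteq> 0"
  shows "\<theta> (p * u) = - \<theta> u / u"
proof -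
  have "qpoch (1 / u) p = (1 - 1 / u) * qpoch (p / u) p"
    using qpoch_split[of "1 / u"] by simp
  moreover have "qpoch u p = (1 - u) * qpoch (p * u) p"
    using qpoch_split[of u] by (simp add: mult.commute)
  moreover have "p / (p * u) = 1 / u" "1 - 1 / u = - ((1 - u) / u)"
    using nz assms by (simp_all add: field_simps)
  ultimately show ?thesis
    by (simp add: theta_def)
qed

lemma theta_inverse:
  assumes "u \<noteq> 0"
  shows "\<theta> (1 / u) = - \<theta> u / u"
  using theta_reflect[of "p * u"] theta_mult_p[OF assms] nz by simp

text \<open>
  The multiplicative lattice of the elliptic curve \<open>\<complex>\<^sup>*/p\<^sup>\<int>\<close>, which is also the zero set of \<open>\<theta>\<close>.
\<close>

definition \<Lambda> :: "complex set"
  where "\<Lambda> = range (\<lambda>k::int. p powi k)"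

lemma \<Lambda>_nz: "u \<in> \<Lambda> \<Longrightarrow> u \<noteq> 0"
  using nz by (auto simp: \<Lambda>_def)

lemma one_in_\<Lambda>: "1 \<in> \<Lambda>"
  unfolding \<Lambda>_def by (rule image_eqI[of _ _ 0]) auto

lemma \<Lambda>_inverse: "u \<in> \<Lambda> \<Longrightarrow> 1 / u \<in> \<Lambda>"
  unfolding \<Lambda>_def by (auto simp: power_int_minus[symmetric] divide_inverse)

lemma theta_eq_0_iff:
  assumes "u \<noteq> 0"
  shows "\<theta> u = 0 \<longleftrightarrow> u \<in> \<Lambda>"
proof
  assume "\<theta> u = 0"
  then consider i where "u * p ^ i = 1" | i where "p / u * p ^ i = 1"
    by (auto simp: theta_def qpoch_eq_0_iff)
  thus "u \<in> \<Lambda>"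
  proof cases
    case 1
    hence "u = p powi (- int i)"
      using nz by (simp add: power_int_minus field_simps)
    thus ?thesis by (auto simp: \<Lambda>_def)
  next
    case 2
    hence "u = p powi (int (Suc i))"
      using nz assms by (simp add: field_simps del: of_nat_Suc)
    thus ?thesis unfolding \<Lambda>_def by blast
  qed
next
  assume "u \<in> \<Lambda>"
  then obtain k :: int where k: "u = p powi k" by (auto simp: \<Lambda>_def)
  show "\<theta> u = 0"
  proof (cases "k \<le> 0")
    case True
    hence "u * p ^ nat (- k) = 1"
      using nz by (simp add: k flip: power_int_of_nat power_int_add)
    thus ?thesis by (auto simp: theta_def qpoch_eq_0_iff)
  next
    case False
    hence "p powi (k - 1) = p ^ nat (k - 1)"
      by (simp flip: power_int_of_nat)
    hence "p * p ^ nat (k - 1) = u"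
      using nz by (simp add: k power_int_diff field_simps)
    hence "p / u * p ^ nat (k - 1) = 1"
      using assms by (simp add: field_simps)
    thus ?thesis by (auto simp: theta_def qpoch_eq_0_iff)
  qed
qed

lemma theta_1: "\<theta> 1 = 0"
  using theta_eq_0_iff[of 1] one_in_\<Lambda> by simp

lemma zero_\<Lambda>_invariant:
  assumes f: "\<And>z::complex. z \<noteq> 0 \<Longrightarrow> f (p * z) = (0::complex) \<longleftrightarrow> f z = 0"
    and "l \<in> \<Lambda>" "z \<noteq> 0"
  shows "f (l * z) = 0 \<longleftrightarrow> f z = 0"
proof -
  have *: "f (p ^ n * z) = 0 \<longleftrightarrow> f z = 0" if "z \<noteq> 0" for n z
    using that by (induction n arbitrary: z) (use f nz in \<open>auto simp: mult.assoc\<close>)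
  obtain k :: int where k: "l = p powi k"
    using assms(2) by (auto simp: \<Lambda>_def)
  show ?thesis
  proof (cases "k \<ge> 0")
    case True
    hence "l = p ^ nat k" by (simp add: k flip: power_int_of_nat)
    thus ?thesis using * assms(3) by simp
  next
    case False
    hence "p ^ nat (- k) * (l * z) = z" "l \<noteq> 0"
      using nz by (simp_all add: k power_int_minus flip: power_int_of_nat mult.assoc)
    thus ?thesis using *[of "l * z" "nat (- k)"] assms(3)
      by (simp only: mult_eq_0_iff simp_thms)
  qed
qed

text \<open>
  Differentiating the quasi-periodicity at a zero shows that being a simple zero is invariant under
  \<open>p\<close>.  At the zero \<open>1\<close>, the theta function is \<open>1 - u\<close> times a function that does not vanish there.
\<close>

lemma deriv_theta_nonzero:
  assumes "u \<in> \<Lambda>"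
  shows "deriv \<theta> u \<noteq> 0"
proof -
  have diff: "(\<theta> has_field_derivative deriv \<theta> w) (at w)" if "w \<noteq> 0" for w
    by (rule holomorphic_derivI[OF holomorphic_theta]) (use that in auto)
  have deriv_p: "deriv \<theta> (p * w) = 0 \<longleftrightarrow> deriv \<theta> w = 0" if w: "w \<noteq> 0" "\<theta> w = 0" for w
  proof -
    have "((\<lambda>w. \<theta> (p * w)) has_field_derivative deriv \<theta> (p * w) * p) (at w)"
      using w nz by (auto intro!: derivative_eq_intros DERIV_chain2[OF diff])
    moreover have "((\<lambda>w. \<theta> (p * w)) has_field_derivative - deriv \<theta> w / w) (at w)"
    proof (rule has_field_derivative_transform_within_open)
      show "((\<lambda>w. - \<theta> w / w) has_field_derivative - deriv \<theta> w / w) (at w)"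
        using w by (auto intro!: derivative_eq_intros diff simp: field_simps power2_eq_square)
      show "- \<theta> v / v = \<theta> (p * v)" if "v \<in> - {0}" for v
        using that theta_mult_p[of v] by simp
    qed (use w in auto)
    ultimately have "deriv \<theta> (p * w) * p = - deriv \<theta> w / w"
      by (rule DERIV_unique)
    thus ?thesis using w nz by (auto simp: field_simps)
  qed
  \<comment> \<open>The zeros of \<open>F\<close> are the multiple zeros of \<open>\<theta>\<close>.\<close>
  define F where "F = (\<lambda>w. if \<theta> w = 0 then deriv \<theta> w else 1)"
  have "F (p * w) = 0 \<longleftrightarrow> F w = 0" if "w \<noteq> 0" for w
    using deriv_p that theta_mult_p[OF that] by (auto simp: F_def)
  hence "F (u * 1) = 0 \<longleftrightarrow> F 1 = 0"
    using assms by (rule zero_\<Lambda>_invariant) auto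
  moreover have "F 1 \<noteq> 0"
  proof -
    define r where "r = (\<lambda>u. qpoch (u * p) p * qpoch (p / u) p)"
    have r: "r holomorphic_on - {0}"
    proof -
      have "(\<lambda>u. qpoch u p) \<circ> (\<lambda>u. p / u) holomorphic_on - {0}"
        "(\<lambda>u. qpoch u p) \<circ> (\<lambda>u. u * p) holomorphic_on - {0}"
        by (rule holomorphic_on_compose_gen[OF _ holomorphic_qpoch];
            auto intro!: holomorphic_intros)+
      thus ?thesis unfolding r_def o_def by (intro holomorphic_intros)
    qed
    have "((\<lambda>u. (1 - u) * r u) has_field_derivative - r 1) (at 1)"
      using holomorphic_derivI[OF r, of 1] by (auto intro!: derivative_eq_intros)
    moreover have "(\<lambda>u. (1 - u) * r u) = \<theta>"
      by (rule ext) (simp add: r_def theta_def qpoch_split[symmetric] flip: mult.assoc)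
    ultimately have "deriv \<theta> 1 = - r 1"
      by (simp add: DERIV_imp_deriv)
    moreover have "qpoch p p \<noteq> 0"
    proof
      assume "qpoch p p = 0"
      then obtain i where "p ^ Suc i = 1" by (auto simp: qpoch_eq_0_iff)
      hence "norm p ^ Suc i = 1" by (metis norm_one norm_power)
      thus False using norm_less_1 nz
        by (metis norm_ge_zero not_less_iff_gr_or_eq power_Suc_less_one zero_less_norm_iff)
    qed
    ultimately show ?thesis by (simp add: F_def r_def)
  qed
  ultimately show ?thesis
    using theta_eq_0_iff[OF \<Lambda>_nz[OF assms]] assms by (auto simp: F_def split: if_splits)
qed

end

section \<open>Dividing by a holomorphic function with simple zeros\<close>

text \<open>
  Near a zero \<open>w\<close> of \<open>g\<close> both functions are divisible by \<open>v - w\<close>, and since the zero of \<open>g\<close> is simple,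
  the remaining factor of \<open>g\<close> does not vanish.  This makes l'Hospital's value the right one at \<open>w\<close>.
\<close>

lemma holomorphic_quotient_simple_zeros:
  assumes "open S" and f: "f holomorphic_on S" and g: "g holomorphic_on S"
    and zeros: "\<And>w. w \<in> S \<Longrightarrow> g w = 0 \<Longrightarrow> f w = 0 \<and> deriv g w \<noteq> 0"
  obtains h where "h holomorphic_on S" "\<And>w. w \<in> S \<Longrightarrow> f w = g w * h w"
proof -
  define h where "h = (\<lambda>w. if g w = 0 then deriv f w / deriv g w else f w / g w)"
  have "h field_differentiable at w" if w: "w \<in> S" for w
  proof -
    have "\<exists>T k. open T \<and> w \<in> T \<and> k holomorphic_on T \<and> (\<forall>v\<in>T. h v = k v)"
    proof (cases "g w = 0")
      case False
      define T where "T = S \<inter> g -` (- {0})"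
      have "open T"
        unfolding T_def using \<open>open S\<close> holomorphic_on_imp_continuous_on[OF g]
        by (intro continuous_open_preimage) auto
      moreover have "(\<lambda>v. f v / g v) holomorphic_on T"
        by (intro holomorphic_intros holomorphic_on_subset[OF f] holomorphic_on_subset[OF g])
          (auto simp: T_def)
      ultimately show ?thesis
        using w False by (intro exI[of _ T] exI[of _ "\<lambda>v. f v / g v"]) (auto simp: T_def h_def)
    next
      case True
      define f1 where "f1 = (\<lambda>v. if v = w then deriv f w else (f v - f w) / (v - w))"
      define g1 where "g1 = (\<lambda>v. if v = w then deriv g w else (g v - g w) / (v - w))"
      have f1: "f1 holomorphic_on S" and g1: "g1 holomorphic_on S"
        unfolding f1_def g1_def using f g w \<open>open S\<close>
        by (auto intro!: pole_lemma simp: interior_open)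
      define T where "T = S \<inter> g1 -` (- {0})"
      have "open T"
        unfolding T_def using \<open>open S\<close> holomorphic_on_imp_continuous_on[OF g1]
        by (intro continuous_open_preimage) auto
      moreover have "w \<in> T"
        using w zeros[OF w True] by (simp add: T_def g1_def)
      moreover have "(\<lambda>v. f1 v / g1 v) holomorphic_on T"
        by (intro holomorphic_intros holomorphic_on_subset[OF f1] holomorphic_on_subset[OF g1])
          (auto simp: T_def)
      moreover have "h v = f1 v / g1 v" if "v \<in> T" for v
        using that True zeros[OF w True]
        by (cases "v = w") (auto simp: T_def h_def f1_def g1_def)
      ultimately show ?thesis by blast
    qed
    then obtain T k where T: "open T" "w \<in> T" "k holomorphic_on T" "\<And>v. v \<in> T \<Longrightarrow> h v = k v"
      by blast
    hence "h holomorphic_on T"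
      by (metis holomorphic_cong)
    thus ?thesis
      using T by (simp add: holomorphic_on_imp_differentiable_at)
  qed
  hence "h holomorphic_on S"
    by (simp add: holomorphic_on_def field_differentiable_at_within)
  thus ?thesis
    using zeros by (intro that[of h]) (auto simp: h_def)
qed

text \<open>
  Cancelling \<open>g\<close> is only a problem at its zeros; there one differentiates the product once.
\<close>

lemma holomorphic_eq_0_simple_zeros:
  assumes "open S" and g: "g holomorphic_on S" and u: "u holomorphic_on S"
    and zeros: "\<And>w. w \<in> S \<Longrightarrow> g w = 0 \<Longrightarrow> deriv g w \<noteq> 0"
    and eq: "\<And>w. w \<in> S \<Longrightarrow> g w * u w = 0"
    and w: "w \<in> S"
  shows "u w = 0"
proof (rule ccontr)
  assume nz: "u w \<noteq> 0"
  hence gw: "g w = 0" using eq[OF w] by simp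
  have "((\<lambda>w. g w * u w) has_field_derivative deriv g w * u w) (at w)"
    using holomorphic_derivI[OF g \<open>open S\<close> w] holomorphic_derivI[OF u \<open>open S\<close> w] gw
    by (auto intro!: derivative_eq_intros)
  moreover have "((\<lambda>w. g w * u w) has_field_derivative 0) (at w)"
    by (rule has_field_derivative_transform_within_open[OF DERIV_const \<open>open S\<close> w, of 0])
      (simp add: eq)
  ultimately show False
    using DERIV_unique zeros[OF w gw] nz by force
qed

section \<open>Theta functions of higher degree\<close>

context nome
begin

text \<open>
  Theta functions of degree \<open>d\<close>: for \<open>K \<noteq> 0\<close>, the sections of a line bundle of degree \<open>d\<close> on
  \<open>\<complex>\<^sup>*/p\<^sup>\<int>\<close>.  Negative degrees are included, since they arise by division.
\<close>

definition theta_fun :: "complex \<Rightarrow> int \<Rightarrow> (complex \<Rightarrow> complex) \<Rightarrow> bool"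
  where "theta_fun K d f \<longleftrightarrow>
    f holomorphic_on - {0} \<and> (\<forall>z. z \<noteq> 0 \<longrightarrow> f (p * z) = K * z powi (- d) * f z)"

lemma theta_funD: "theta_fun K d f \<Longrightarrow> z \<noteq> 0 \<Longrightarrow> f (p * z) = K * z powi (- d) * f z"
  by (simp add: theta_fun_def)

lemma theta_fun_zero_\<Lambda>:
  assumes "theta_fun K d f" "K \<noteq> 0" "l \<in> \<Lambda>" "z \<noteq> 0"
  shows "f (l * z) = 0 \<longleftrightarrow> f z = 0"
proof (rule zero_\<Lambda>_invariant[of f])
  show "f (p * w) = 0 \<longleftrightarrow> f w = 0" if "w \<noteq> 0" for w
    using assms that by (simp add: theta_fun_def)
qed (use assms in auto)

lemma theta_fun_mult:
  assumes "theta_fun K d f" "theta_fun L e g"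
  shows "theta_fun (K * L) (d + e) (\<lambda>z. f z * g z)"
  unfolding theta_fun_def
proof (intro conjI allI impI)
  show "(\<lambda>z. f z * g z) holomorphic_on - {0}"
    using assms by (intro holomorphic_on_mult) (simp_all only: theta_fun_def)
  fix z :: complex assume z: "z \<noteq> 0"
  hence "f (p * z) * g (p * z) = (K * z powi (- d) * f z) * (L * z powi (- e) * g z)"
    using assms by (simp only: theta_fun_def) simp
  also have "\<dots> = K * L * (z powi (- d) * z powi (- e)) * (f z * g z)"
    by (simp only: mult_ac)
  also have "z powi (- d) * z powi (- e) = z powi (- (d + e))"
    using z by (simp flip: power_int_add)
  finally show "f (p * z) * g (p * z) = K * L * z powi (- (d + e)) * (f z * g z)" .
qed

lemma theta_fun_diff:
  assumes "theta_fun K d f" "theta_fun K d g"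
  shows "theta_fun K d (\<lambda>z. f z - g z)"
  using assms unfolding theta_fun_def by (simp add: holomorphic_on_diff right_diff_distrib)

lemma theta_fun_const: "theta_fun 1 0 (\<lambda>z. c)"
  by (simp add: theta_fun_def)

lemma theta_fun_monomial: "theta_fun (p ^ n) 0 (\<lambda>z. z ^ n)"
  unfolding theta_fun_def by (simp add: holomorphic_on_power power_mult_distrib)

lemma theta_fun_theta:
  assumes "c \<noteq> 0"
  shows "theta_fun (- 1 / c) 1 (\<lambda>z. \<theta> (c * z))"
  unfolding theta_fun_def
proof (intro conjI allI impI)
  show "(\<lambda>z. \<theta> (c * z)) holomorphic_on - {0}"
    using assms by (intro holomorphic_theta_compose holomorphic_intros) auto
  fix z :: complex assume "z \<noteq> 0"
  thus "\<theta> (c * (p * z)) = - 1 / c * z powi - 1 * \<theta> (c * z)"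
    using theta_mult_p[of "c * z"] assms
    by (simp add: mult.left_commute power_int_minus field_simps)
qed

lemma theta_fun_reflect:
  assumes "theta_fun K d f" "K \<noteq> 0" "c \<noteq> 0"
  shows "theta_fun (1 / K * (c / p) powi d) d (\<lambda>z. f (c / z))"
  unfolding theta_fun_def
proof (intro conjI allI impI)
  have "f \<circ> (\<lambda>z. c / z) holomorphic_on - {0}"
    using assms unfolding theta_fun_def
    by (intro holomorphic_on_compose_gen[where t = "- {0}"] holomorphic_intros) auto
  thus "(\<lambda>z. f (c / z)) holomorphic_on - {0}" by (simp add: o_def)
  fix z :: complex assume z: "z \<noteq> 0"
  define w where "w = c / (p * z)"
  have w: "w \<noteq> 0" "c / z = p * w" "c / p = w * z"
    using z nz assms(3) by (simp_all add: w_def)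
  have "f (c / z) = K * w powi (- d) * f w"
    using assms(1) w by (simp add: theta_fun_def)
  thus "f (c / (p * z)) = 1 / K * (c / p) powi d * z powi (- d) * f (c / z)"
    using w z assms(2) unfolding w_def[symmetric]
    by (simp add: power_int_mult_distrib power_int_minus field_simps)
qed

text \<open>
  The multiplier of the quotient is the quotient of the multipliers; off the zeros of \<open>g\<close> this is
  immediate, and at the zeros it follows from the cancellation lemma.
\<close>

lemma theta_fun_quotient:
  assumes f: "theta_fun K d f" and g: "theta_fun A m g" and "A \<noteq> 0"
    and zeros: "\<And>w. w \<noteq> 0 \<Longrightarrow> g w = 0 \<Longrightarrow> f w = 0 \<and> deriv g w \<noteq> 0"
  obtains h where "theta_fun (K / A) (d - m) h" "\<And>w. w \<noteq> 0 \<Longrightarrow> f w = g w * h w"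
proof -
  have hol: "f holomorphic_on - {0}" "g holomorphic_on - {0}"
    using f g by (auto simp: theta_fun_def)
  obtain h where h: "h holomorphic_on - {0}" and fgh: "\<And>w. w \<in> - {0} \<Longrightarrow> f w = g w * h w"
    by (rule holomorphic_quotient_simple_zeros[OF _ hol]) (use zeros in auto)
  have "h (p * w) - K / A * w powi (m - d) * h w = 0" if w: "w \<noteq> 0" for w
  proof (rule holomorphic_eq_0_simple_zeros[OF _ hol(2), where u = "\<lambda>w. h (p * w) - K / A * w powi (m - d) * h w"])
    have "h \<circ> (\<lambda>w. p * w) holomorphic_on - {0}"
      by (rule holomorphic_on_compose_gen[OF _ h]) (use nz in \<open>auto intro!: holomorphic_intros\<close>)
    thus "(\<lambda>w. h (p * w) - K / A * w powi (m - d) * h w) holomorphic_on - {0}"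
      unfolding o_def by (intro holomorphic_intros h) auto
    show "g w * (h (p * w) - K / A * w powi (m - d) * h w) = 0" if "w \<in> - {0}" for w
    proof -
      have w: "w \<noteq> 0" using that by auto
      have "g (p * w) * h (p * w) = K * w powi (- d) * (g w * h w)"
        using fgh[of w] fgh[of "p * w"] f w nz by (simp add: theta_fun_def)
      hence "A * w powi (- m) * g w * h (p * w) = K * w powi (- d) * (g w * h w)"
        using g w by (simp add: theta_fun_def)
      thus ?thesis
        using w \<open>A \<noteq> 0\<close> by (simp add: power_int_diff power_int_minus field_simps)
    qed
  qed (use w zeros in auto)
  hence "theta_fun (K / A) (d - m) h"
    using h by (simp add: theta_fun_def)
  thus ?thesis using that fgh by auto
qed

text \<open>
  A line bundle of degree -1 has no sections.  Write \<open>z = exp w\<close> and \<open>\<rho> = log p\<close>.  Then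
  \<open>h(w) = f(exp w)\<close> has period \<open>2\<pi>\<i>\<close> and satisfies \<open>h(w + \<rho>) = K e\<^sup>w h(w)\<close>.  Multiplying \<open>|h|\<close> by a
  suitable growing Gaussian in \<open>Re w\<close> makes it doubly periodic, hence bounded, so \<open>h\<close> itself decays
  like the reciprocal Gaussian.  Liouville's theorem makes \<open>h\<close> constant, and the factor \<open>e\<^sup>w\<close> makes
  the constant 0.
\<close>

lemma theta_fun_degree_minus_1:
  assumes f: "theta_fun K (- 1) f" and "z \<noteq> 0"
  shows "f z = 0"
proof (cases "K = 0")
  case True
  thus ?thesis
    using f assms(2) nz unfolding theta_fun_def
    by (metis mult_zero_left mult_eq_0_iff nonzero_mult_div_cancel_left times_divide_eq_right divide_eq_0_iff)
next
  case K: False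
  define \<rho> where "\<rho> = Ln p"
  define R where "R = Re \<rho>"
  define h where "h = (\<lambda>w. f (exp w))"
  have exp_\<rho>: "exp \<rho> = p" using nz by (simp add: \<rho>_def)
  have R: "R < 0"
    using nz norm_less_1 by (simp add: R_def \<rho>_def)
  have hol: "h holomorphic_on UNIV"
  proof -
    have "f \<circ> exp holomorphic_on UNIV"
      using f by (intro holomorphic_on_compose_gen[where t = "- {0}"] holomorphic_intros)
        (auto simp: theta_fun_def)
    thus ?thesis by (simp add: h_def o_def)
  qed
  have h_\<rho>: "h (w + \<rho>) = K * exp w * h w" for w
  proof -
    have "f (p * exp w) = K * exp w powi - (- 1) * f (exp w)"
      using f by (simp only: theta_fun_def) simp
    thus ?thesis by (simp add: h_def exp_add exp_\<rho> mult.commute)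
  qed
  have h_2pi: "h (w + 2 * of_real pi * \<i>) = h w" for w
    by (simp only: h_def exp_add exp_two_pi_i mult_1_right)
  \<comment> \<open>The exponent \<open>g(y)\<close>, for \<open>y = Re w\<close>, solves \<open>ln |K| + y + g(y + R) = g(y)\<close>, so that \<open>\<phi>\<close> has period \<open>\<rho>\<close>.\<close>
  define \<phi> where "\<phi> = (\<lambda>w. norm (h w) * exp (- (Re w)\<^sup>2 / (2 * R) + (1 / 2 - ln (norm K) / R) * Re w))"
  have \<phi>_\<rho>: "\<phi> (w + \<rho>) = \<phi> w" for w
  proof -
    have "ln (norm K) + Re w + (- (Re w + R)\<^sup>2 / (2 * R) + (1 / 2 - ln (norm K) / R) * (Re w + R))
        = - (Re w)\<^sup>2 / (2 * R) + (1 / 2 - ln (norm K) / R) * Re w"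
      using R by (simp add: field_simps power2_eq_square)
    moreover have "\<phi> (w + \<rho>) = norm (h w) * exp (ln (norm K) + Re w + (- (Re w + R)\<^sup>2 / (2 * R) + (1 / 2 - ln (norm K) / R) * (Re w + R)))"
      using K by (simp add: \<phi>_def h_\<rho> norm_mult exp_add R_def)
    ultimately show ?thesis by (simp only: \<phi>_def)
  qed
  have \<phi>_2pi: "\<phi> (w + 2 * of_real pi * \<i>) = \<phi> w" for w
    by (simp add: \<phi>_def h_2pi)
  have shift: "\<phi> (w + of_int k * v) = \<phi> w" if v: "\<And>w. \<phi> (w + v) = \<phi> w" for v w k
  proof (induction k arbitrary: w rule: int_induct[of _ 0])
    case (step1 i)
    thus ?case using v[of "w + of_int i * v"] by (simp add: algebra_simps)
  next
    case (step2 i)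
    thus ?case using v[of "w + of_int (i - 1) * v"] by (simp add: algebra_simps)
  qed auto
  define B where "B = {w. Re w \<in> {R..0} \<and> Im w \<in> {0..2 * pi}}"
  have "B = cbox (Complex R 0) (Complex 0 (2 * pi))"
    by (auto simp: B_def in_cbox_complex_iff)
  hence "compact B" by simp
  moreover have cont_h: "continuous_on UNIV h"
    using hol by (rule holomorphic_on_imp_continuous_on)
  hence "continuous_on B \<phi>"
    unfolding \<phi>_def by (intro continuous_intros continuous_on_subset[OF cont_h]) (use R in auto)
  ultimately have "bounded (\<phi> ` B)"
    by (intro compact_imp_bounded compact_continuous_image)
  then obtain M where M: "\<And>w. w \<in> B \<Longrightarrow> \<bar>\<phi> w\<bar> \<le> M"
    by (auto simp: bounded_iff)
  have \<phi>_le: "\<phi> w \<le> M" for w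
  proof -
    \<comment> \<open>Move \<open>w\<close> into the fundamental rectangle \<open>B\<close>, first horizontally by \<open>\<rho>\<close>, then vertically by \<open>2\<pi>\<i>\<close>.\<close>
    define k where "k = \<lfloor>Re w / R\<rfloor>"
    define w' where "w' = w + of_int (- k) * \<rho>"
    define l where "l = \<lfloor>Im w' / (2 * pi)\<rfloor>"
    define w'' where "w'' = w' + of_int (- l) * (2 * of_real pi * \<i>)"
    have "of_int k \<le> Re w / R" "Re w / R < of_int k + 1"
      unfolding k_def by linarith+
    hence "Re w \<le> of_int k * R" "(of_int k + 1) * R < Re w"
      using R by (simp_all add: field_simps)
    hence 1: "Re w'' \<in> {R..0}"
      by (simp add: w''_def w'_def R_def algebra_simps)
    have "of_int l \<le> Im w' / (2 * pi)" "Im w' / (2 * pi) < of_int l + 1"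
      unfolding l_def by linarith+
    hence "of_int l * (2 * pi) \<le> Im w'" "Im w' < (of_int l + 1) * (2 * pi)"
      by (simp_all add: field_simps)
    hence 2: "Im w'' \<in> {0..2 * pi}"
      by (simp add: w''_def algebra_simps)
    have "\<phi> w'' = \<phi> w"
      unfolding w''_def w'_def by (simp only: shift[OF \<phi>_\<rho>] shift[OF \<phi>_2pi])
    thus ?thesis using M[of w''] 1 2 by (simp add: B_def)
  qed
  have "bounded (range h)"
  proof -
    define \<beta> where "\<beta> = 1 / 2 - ln (norm K) / R"
    have "norm (h w) \<le> M * exp (- R * \<beta>\<^sup>2 / 2)" for w
    proof -
      define y where "y = Re w"
      \<comment> \<open>Completing the square bounds the reciprocal of the Gaussian weight.\<close>
      have "0 \<le> (y - \<beta> * R)\<^sup>2 / (- 2 * R)" using R by (intro divide_nonneg_pos) auto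
      also have "(y - \<beta> * R)\<^sup>2 / (- 2 * R) = - y\<^sup>2 / (2 * R) + \<beta> * y - R * \<beta>\<^sup>2 / 2"
        using R by (simp add: field_simps power2_eq_square)
      finally have "1 \<le> exp (- y\<^sup>2 / (2 * R) + \<beta> * y) * exp (- R * \<beta>\<^sup>2 / 2)"
        by (simp flip: exp_add)
      hence "norm (h w) * 1 \<le> norm (h w) * (exp (- y\<^sup>2 / (2 * R) + \<beta> * y) * exp (- R * \<beta>\<^sup>2 / 2))"
        by (intro mult_left_mono) auto
      also have "\<dots> = \<phi> w * exp (- R * \<beta>\<^sup>2 / 2)"
        by (simp add: \<phi>_def \<beta>_def y_def)
      also have "\<dots> \<le> M * exp (- R * \<beta>\<^sup>2 / 2)"
        using \<phi>_le by (intro mult_right_mono) auto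
      finally show ?thesis by simp
    qed
    thus ?thesis unfolding bounded_iff by blast
  qed
  then obtain C where C: "\<And>w. h w = C"
    using Liouville_theorem[OF hol] by (auto simp: constant_on_def)
  have "C = K * C" "C = - K * C"
    using h_\<rho>[of 0] h_\<rho>[of "of_real pi * \<i>"] by (simp_all add: C)
  hence "C = 0" using K by (auto simp: eq_neg_iff_add_eq_0)
  thus ?thesis
    using C[of "Ln z"] assms(2) by (simp add: h_def)
qed

text \<open>
  A nonzero section of a line bundle of degree \<open>d\<close> has \<open>d\<close> zeros.  For one zero more than that,
  divide by \<open>\<theta>(z/c)\<close> for one zero \<open>c\<close> after the other.  This lowers the degree by one each time and
  keeps the remaining zeros, as they are inequivalent to \<open>c\<close>; at the end the degree is -1.
\<close>

theorem theta_fun_eq_0: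
  assumes "theta_fun K (int (length cs) - 1) f"
    and "\<And>c. c \<in> set cs \<Longrightarrow> c \<noteq> 0 \<and> f c = 0"
    and "sorted_wrt (\<lambda>c c'. c' / c \<notin> \<Lambda>) cs"
    and "K \<noteq> 0" "z \<noteq> 0"
  shows "f z = 0"
  using assms
proof (induction cs arbitrary: K f)
  case Nil
  thus ?case by (auto intro: theta_fun_degree_minus_1)
next
  case (Cons c cs)
  have c: "c \<noteq> 0" "f c = 0" using Cons.prems(2) by auto
  define g where "g = (\<lambda>z. \<theta> (1 / c * z))"
  have g: "theta_fun (- c) 1 g"
    using theta_fun_theta[of "1 / c"] c by (simp add: g_def)
  have g_0_iff: "g w = 0 \<longleftrightarrow> w / c \<in> \<Lambda>" if "w \<noteq> 0" for w
    using theta_eq_0_iff[of "1 / c * w"] c that by (simp add: g_def)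
  obtain h where h: "theta_fun (K / - c) (int (length (c # cs)) - 1 - 1) h"
    and fgh: "\<And>w. w \<noteq> 0 \<Longrightarrow> f w = g w * h w"
  proof (rule theta_fun_quotient[OF Cons.prems(1) g])
    fix w :: complex
    assume w: "w \<noteq> 0" "g w = 0"
    hence *: "w / c \<in> \<Lambda>" using g_0_iff by simp
    have "f w = 0"
      using theta_fun_zero_\<Lambda>[OF Cons.prems(1) \<open>K \<noteq> 0\<close> * c(1)] c by simp
    moreover have "(g has_field_derivative deriv \<theta> (1 / c * w) * (1 / c)) (at w)"
      unfolding g_def using w c
      by (intro DERIV_chain2[OF holomorphic_derivI[OF holomorphic_theta]])
        (auto intro!: derivative_eq_intros)
    hence "deriv g w = deriv \<theta> (w / c) / c"
      by (simp add: DERIV_imp_deriv)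
    ultimately show "f w = 0 \<and> deriv g w \<noteq> 0"
      using deriv_theta_nonzero[OF *] c by simp
  qed (use c in auto)
  have "h z = 0"
  proof (rule Cons.IH)
    show "theta_fun (K / - c) (int (length cs) - 1) h"
      using h by simp
    fix c' assume c': "c' \<in> set cs"
    hence "c' \<noteq> 0" "f c' = 0" "g c' \<noteq> 0"
      using Cons.prems(2)[of c'] Cons.prems(3) g_0_iff[of c'] by auto
    thus "c' \<noteq> 0 \<and> h c' = 0"
      using fgh[of c'] by simp
  qed (use Cons.prems c in auto)
  thus ?case using fgh Cons.prems by simp
qed

section \<open>The four-term theta identity\<close>

lemma theta_fun_mult_arg:
  assumes "theta_fun K d f" "c \<noteq> 0"
  shows "theta_fun (K * c powi (- d)) d (\<lambda>z. f (c * z))"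
  unfolding theta_fun_def
proof (intro conjI allI impI)
  have "f \<circ> (\<lambda>z. c * z) holomorphic_on - {0}"
    using assms unfolding theta_fun_def
    by (intro holomorphic_on_compose_gen[where t = "- {0}"] holomorphic_intros) auto
  thus "(\<lambda>z. f (c * z)) holomorphic_on - {0}" by (simp add: o_def)
  fix z :: complex assume z: "z \<noteq> 0"
  have "f (p * (c * z)) = K * (c * z) powi (- d) * f (c * z)"
    using assms z by (simp only: theta_fun_def) simp
  thus "f (c * (p * z)) = K * c powi (- d) * z powi (- d) * f (c * z)"
    by (simp add: power_int_mult_distrib mult_ac)
qed

lemma theta_fun_theta_square: "theta_fun (1 / p) 4 (\<lambda>z. \<theta> (z\<^sup>2))"
  unfolding theta_fun_def
proof (intro conjI allI impI)
  show "(\<lambda>z. \<theta> (z\<^sup>2)) holomorphic_on - {0}"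
    by (intro holomorphic_theta_compose holomorphic_intros) auto
  fix z :: complex assume z: "z \<noteq> 0"
  have "\<theta> ((p * z)\<^sup>2) = \<theta> (p * (p * z\<^sup>2))"
    by (simp add: power2_eq_square mult_ac)
  also have "\<dots> = - (- \<theta> (z\<^sup>2) / z\<^sup>2) / (p * z\<^sup>2)"
    using z nz by (simp add: theta_mult_p)
  also have "\<dots> = 1 / p * z powi (- 4) * \<theta> (z\<^sup>2)"
    using z nz by (simp add: power_int_minus field_simps flip: power_add)
  finally show "\<theta> ((p * z)\<^sup>2) = 1 / p * z powi (- 4) * \<theta> (z\<^sup>2)" .
qed

lemma deriv_theta_square:
  assumes "w \<noteq> 0" "\<theta> (w\<^sup>2) = 0"
  shows "deriv (\<lambda>z. \<theta> (z\<^sup>2)) w \<noteq> 0"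
proof -
  have "((\<lambda>z. \<theta> (z\<^sup>2)) has_field_derivative deriv \<theta> (w\<^sup>2) * (2 * w)) (at w)"
    using assms
    by (intro DERIV_chain2[OF holomorphic_derivI[OF holomorphic_theta]])
      (auto intro!: derivative_eq_intros)
  thus ?thesis
    using deriv_theta_nonzero[of "w\<^sup>2"] theta_eq_0_iff[of "w\<^sup>2"] assms
    by (simp add: DERIV_imp_deriv)
qed

text \<open>
  The points with \<open>z\<^sup>2 \<in> \<Lambda>\<close> are, up to the lattice, the fixed points \<open>y\<^sup>2 = 1\<close> of \<open>y \<mapsto> 1/y\<close> and the
  fixed points \<open>y\<^sup>2 = p\<close> of \<open>y \<mapsto> p/y\<close>.  The multiplier is exactly the one for which \<open>f\<close> is odd at both
  kinds of points.
\<close>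

lemma odd_theta_fun_eq_0:
  assumes f: "theta_fun (1 / p\<^sup>2) 6 f"
    and odd: "\<And>z. z \<noteq> 0 \<Longrightarrow> f (1 / z) = - f z / z\<^sup>2"
    and z: "z \<noteq> 0" "z\<^sup>2 \<in> \<Lambda>"
  shows "f z = 0"
proof -
  obtain k :: int where k: "z\<^sup>2 = p powi k" using z by (auto simp: \<Lambda>_def)
  \<comment> \<open>Splitting off the even part of the exponent leaves \<open>y\<^sup>2 = p\<^sup>0\<close> or \<open>y\<^sup>2 = p\<^sup>1\<close>.\<close>
  define l where "l = p powi (k div 2)"
  define y where "y = z / l"
  have l: "l \<in> \<Lambda>" "l \<noteq> 0" using nz by (auto simp: l_def \<Lambda>_def)
  have y: "y \<noteq> 0" "z = l * y" using l z by (simp_all add: y_def)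
  have "p powi k = p powi (k mod 2) * (p powi (k div 2))\<^sup>2"
    using nz by (simp add: power2_eq_square flip: power_int_add)
  hence "y\<^sup>2 = p powi (k mod 2)"
    using l k by (simp add: y_def power_divide l_def)
  moreover have "k mod 2 = 0 \<or> k mod 2 = 1" by presburger
  ultimately consider "y\<^sup>2 = 1" | "y\<^sup>2 = p" by fastforce
  hence "f y = - f y"
  proof cases
    case 1
    hence "1 / y = y" using y by (simp add: field_simps power2_eq_square)
    thus ?thesis using odd[OF y(1)] 1 by simp
  next
    case 2
    hence p_y: "p * (1 / y) = y" using y by (simp add: field_simps power2_eq_square)
    have "f (p * (1 / y)) = 1 / p\<^sup>2 * (1 / y) powi (- 6) * f (1 / y)"
      using theta_funD[OF f, of "1 / y"] y by simp
    also have "(1 / y) powi (- 6) = p ^ 3"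
      by (simp add: power_int_minus power_divide 2[symmetric] flip: power_mult)
    also have "f (1 / y) = - f y / p"
      using odd[OF y(1)] 2 by simp
    finally have "f (p * (1 / y)) = - f y"
      using nz by (simp add: power2_eq_square power3_eq_cube)
    thus ?thesis by (simp only: p_y)
  qed
  hence "f y = 0" by (simp add: eq_neg_iff_add_eq_0)
  thus ?thesis
    using theta_fun_zero_\<Lambda>[OF f _ l(1) y(1)] nz y(2) by simp
qed

text \<open>
  Both sides of the four-term identity, multiplied by \<open>\<theta>(x\<^sup>2) \<theta>(z\<^sup>2)\<close> and subtracted.  The factors
  \<open>- x\<^sup>2\<close> and \<open>- z\<^sup>2\<close> are the values of \<open>\<theta>(x\<^sup>2) / \<theta>(x\<^sup>-\<^sup>2)\<close> and \<open>\<theta>(z\<^sup>2) / \<theta>(z\<^sup>-\<^sup>2)\<close>; with them no theta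
  function is left in a denominator.
\<close>

definition defect :: "complex \<Rightarrow> (complex \<Rightarrow> complex) \<Rightarrow> complex \<Rightarrow> complex \<Rightarrow> complex"
  where "defect e Q x z =
    \<theta> (z\<^sup>2) * (\<theta> (e * x / z) * \<theta> (e * x * z) * Q x
              - x\<^sup>2 * \<theta> (e / x / z) * \<theta> (e / x * z) * Q (1 / x))
    - \<theta> (x\<^sup>2) * (\<theta> (e / x * z) * \<theta> (e * x * z) * Q (e / z)
              - z\<^sup>2 * \<theta> (e * x / z) * \<theta> (e / x / z) * Q (e * z))"

lemma defect_inverse_right:
  assumes "x \<noteq> 0" "z \<noteq> 0"
  shows "defect e Q x (1 / z) = - defect e Q x z / z\<^sup>2"
  using assms theta_inverse[of "z\<^sup>2"] by (simp add: defect_def power_divide) (simp add: field_simps)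

lemma defect_inverse_left:
  assumes "x \<noteq> 0" "z \<noteq> 0"
  shows "defect e Q (1 / x) z = - defect e Q x z / x\<^sup>2"
  using assms theta_inverse[of "x\<^sup>2"] by (simp add: defect_def power_divide) (simp add: field_simps)

text \<open>
  At \<open>z = e x\<close> the factor \<open>\<theta>(e x/z)\<close> is \<open>\<theta>(1) = 0\<close>, and the two surviving terms carry the same
  value \<open>Q(1/x) = Q(e/z)\<close>.
\<close>

lemma defect_at_mult:
  assumes "x \<noteq> 0" "e \<noteq> 0"
  shows "defect e Q x (e * x) = 0"
proof -
  have "e / x / (e * x) = 1 / x\<^sup>2" "e / x * (e * x) = e\<^sup>2" "e * x * (e * x) = (e * x)\<^sup>2"
    "e / (e * x) = 1 / x" "e * x / (e * x) = 1"
    using assms by (simp_all add: field_simps power2_eq_square)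
  thus ?thesis
    using assms theta_inverse[of "x\<^sup>2"]
    by (simp only: defect_def theta_1) simp
qed

lemma defect_at_divide:
  assumes "x \<noteq> 0" "e \<noteq> 0"
  shows "defect e Q x (e / x) = 0"
  using defect_at_mult[of "1 / x" e Q] defect_inverse_left[of x "e / x" e Q] assms by simp

text \<open>
  The multiplier of \<open>Q\<close> is the one for which all four terms have the same multiplier in \<open>z\<close>.
\<close>

lemma theta_fun_defect:
  assumes Q: "theta_fun (e\<^sup>2 / p\<^sup>2) 4 Q" and [simp]: "e \<noteq> 0" "x \<noteq> 0"
  shows "theta_fun (1 / p\<^sup>2) 6 (defect e Q x)"
proof -
  note [simp] = nz
  have th: "theta_fun (- 1 / c) 1 (\<lambda>z. \<theta> (c * z))" if "c \<noteq> 0" for c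
    using that by (rule theta_fun_theta)
  have th': "theta_fun (- c / p) 1 (\<lambda>z. \<theta> (c / z))" if "c \<noteq> 0" for c
    using theta_fun_reflect[OF theta_fun_theta[of 1], of c] that by simp
  have Q1: "theta_fun (e\<^sup>2 / p\<^sup>2) 4 (\<lambda>z. Q (e / z))"
    using theta_fun_reflect[OF Q, of e]
    by (simp add: field_simps power2_eq_square power4_eq_xxxx)
  have Q2: "theta_fun (1 / (p\<^sup>2 * e\<^sup>2)) 4 (\<lambda>z. Q (e * z))"
    using theta_fun_mult_arg[OF Q, of e]
    by (simp add: power_int_minus field_simps power2_eq_square power4_eq_xxxx)
  have "theta_fun (1 / p) 2 (\<lambda>z. \<theta> (e * x / z) * \<theta> (e * x * z) * Q x)"
    using theta_fun_mult[OF theta_fun_mult[OF th' th] theta_fun_const[of "Q x"], of "e * x" "e * x"]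
    by (simp add: field_simps)
  moreover have "theta_fun (1 / p) 2 (\<lambda>z. x\<^sup>2 * \<theta> (e / x / z) * \<theta> (e / x * z) * Q (1 / x))"
    using theta_fun_mult[OF theta_fun_mult[OF theta_fun_mult[OF theta_fun_const[of "x\<^sup>2"] th'] th]
        theta_fun_const[of "Q (1 / x)"], of "e / x" "e / x"]
    by (simp add: field_simps)
  ultimately have "theta_fun (1 / p * (1 / p)) (4 + 2) (\<lambda>z. \<theta> (z\<^sup>2) *
      (\<theta> (e * x / z) * \<theta> (e * x * z) * Q x - x\<^sup>2 * \<theta> (e / x / z) * \<theta> (e / x * z) * Q (1 / x)))"
    by (intro theta_fun_mult[OF theta_fun_theta_square] theta_fun_diff)
  hence 1: "theta_fun (1 / p\<^sup>2) 6 (\<lambda>z. \<theta> (z\<^sup>2) *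
      (\<theta> (e * x / z) * \<theta> (e * x * z) * Q x - x\<^sup>2 * \<theta> (e / x / z) * \<theta> (e / x * z) * Q (1 / x)))"
    by (simp add: power2_eq_square)
  have "theta_fun (1 / p\<^sup>2) 6 (\<lambda>z. \<theta> (e / x * z) * \<theta> (e * x * z) * Q (e / z))"
    using theta_fun_mult[OF theta_fun_mult[OF th th] Q1, of "e / x" "e * x"]
    by (simp add: field_simps power2_eq_square)
  moreover have "theta_fun (1 / p\<^sup>2) 6 (\<lambda>z. z\<^sup>2 * \<theta> (e * x / z) * \<theta> (e / x / z) * Q (e * z))"
    using theta_fun_mult[OF theta_fun_mult[OF theta_fun_mult[OF theta_fun_monomial[of 2] th'] th'] Q2,
        of "e * x" "e / x"]
    by (simp add: field_simps power2_eq_square)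
  ultimately have 2: "theta_fun (1 / p\<^sup>2) 6 (\<lambda>z. \<theta> (x\<^sup>2) *
      (\<theta> (e / x * z) * \<theta> (e * x * z) * Q (e / z) - z\<^sup>2 * \<theta> (e * x / z) * \<theta> (e / x / z) * Q (e * z)))"
    using theta_fun_mult[OF theta_fun_const theta_fun_diff] by fastforce
  show ?thesis
    using theta_fun_diff[OF 1 2] by (simp add: defect_def[abs_def])
qed

text \<open>
  By oddness \<open>\<theta>(z\<^sup>2)\<close>, of degree 4, can be split off.  The quotient has degree 2 and still has the
  zeros \<open>e x\<close>, \<open>e/x\<close> and \<open>1/(e x)\<close>.  The genericity assumptions say that these three are pairwise
  inequivalent modulo \<open>\<Lambda>\<close> and no zeros of \<open>\<theta>(z\<^sup>2)\<close>.
\<close>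

lemma defect_eq_0_generic:
  assumes Q: "theta_fun (e\<^sup>2 / p\<^sup>2) 4 Q" and [simp]: "e \<noteq> 0" "x \<noteq> 0" "z \<noteq> 0"
    and generic: "e\<^sup>2 \<notin> \<Lambda>" "x\<^sup>2 \<notin> \<Lambda>" "(e * x)\<^sup>2 \<notin> \<Lambda>" "(e / x)\<^sup>2 \<notin> \<Lambda>"
  shows "defect e Q x z = 0"
proof -
  note E = theta_fun_defect[OF Q \<open>e \<noteq> 0\<close> \<open>x \<noteq> 0\<close>]
  have \<Lambda>_inverse_iff: "1 / u \<in> \<Lambda> \<longleftrightarrow> u \<in> \<Lambda>" for u
    using \<Lambda>_inverse[of u] \<Lambda>_inverse[of "1 / u"] by auto
  obtain h where h: "theta_fun (1 / p\<^sup>2 / (1 / p)) (6 - 4) h"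
    and eq: "\<And>w. w \<noteq> 0 \<Longrightarrow> defect e Q x w = \<theta> (w\<^sup>2) * h w"
  proof (rule theta_fun_quotient[OF E theta_fun_theta_square])
    fix w :: complex assume w: "w \<noteq> 0" "\<theta> (w\<^sup>2) = 0"
    have "defect e Q x w = 0"
      by (rule odd_theta_fun_eq_0[OF E])
        (use w theta_eq_0_iff[of "w\<^sup>2"] in \<open>auto simp: defect_inverse_right\<close>)
    thus "defect e Q x w = 0 \<and> deriv (\<lambda>z. \<theta> (z\<^sup>2)) w \<noteq> 0"
      using deriv_theta_square[OF w] by simp
  qed (use nz in auto)
  have zero: "h c = 0" if "c \<noteq> 0" "c\<^sup>2 \<notin> \<Lambda>" "defect e Q x c = 0" for c
    using eq[of c] theta_eq_0_iff[of "c\<^sup>2"] that by simp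
  have "h z = 0"
  proof (rule theta_fun_eq_0[where cs = "[e * x, e / x, 1 / (e * x)]" and f = h and K = "1 / p"])
    show "theta_fun (1 / p) (int (length [e * x, e / x, 1 / (e * x)]) - 1) h"
      using h by (simp add: power2_eq_square nz)
    show "c \<noteq> 0 \<and> h c = 0" if "c \<in> set [e * x, e / x, 1 / (e * x)]" for c
    proof
      show c: "c \<noteq> 0" using that by auto
      show "h c = 0"
      proof (rule zero[OF c])
        have "(1 / (e * x))\<^sup>2 = 1 / (e * x)\<^sup>2" by (simp add: power_divide)
        thus "c\<^sup>2 \<notin> \<Lambda>"
          using that generic by (auto simp: \<Lambda>_inverse_iff simp del: power_mult_distrib)
        show "defect e Q x c = 0"
          using that defect_at_mult[of x e Q] defect_at_divide[of x e Q]
            defect_inverse_right[of x "e * x" e Q] by auto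
      qed
    qed
    have "(e / x) / (e * x) = 1 / x\<^sup>2" "(1 / (e * x)) / (e * x) = 1 / (e * x)\<^sup>2"
      "(1 / (e * x)) / (e / x) = 1 / e\<^sup>2"
      by (simp_all add: field_simps power2_eq_square)
    thus "sorted_wrt (\<lambda>c c'. c' / c \<notin> \<Lambda>) [e * x, e / x, 1 / (e * x)]"
      using generic by (simp only: sorted_wrt.simps \<Lambda>_inverse_iff) (simp add: \<Lambda>_inverse_iff)
  qed (use nz in auto)
  thus ?thesis using eq by simp
qed

text \<open>
  Along a logarithmic ray, the modulus determines the parameter, so each of the countably many
  lattice points is met at most once.
\<close>

lemma countable_\<Lambda>_exp:
  assumes "u \<noteq> 0" "m \<noteq> 0"
  shows "countable {t::real. u * exp (of_real (m * t)) \<in> \<Lambda>}"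
proof (rule countable_subset)
  show "{t::real. u * exp (of_real (m * t)) \<in> \<Lambda>} \<subseteq> (\<lambda>l. ln (norm (l / u)) / m) ` \<Lambda>"
  proof (intro subsetI image_eqI)
    fix t assume t: "t \<in> {t::real. u * exp (of_real (m * t)) \<in> \<Lambda>}"
    thus "u * exp (of_real (m * t)) \<in> \<Lambda>" by simp
    show "t = ln (norm (u * exp (of_real (m * t)) / u)) / m"
      using assms by simp
  qed
  show "countable ((\<lambda>l. ln (norm (l / u)) / m) ` \<Lambda>)"
    by (simp add: \<Lambda>_def)
qed

lemma continuous_on_theta:
  assumes "continuous_on A f" "\<And>t. t \<in> A \<Longrightarrow> f t \<noteq> 0"
  shows "continuous_on A (\<lambda>t. \<theta> (f t))"
proof (rule continuous_on_compose2[OF _ assms(1)])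
  show "continuous_on (- {0}) \<theta>"
    by (rule holomorphic_on_imp_continuous_on[OF holomorphic_theta])
qed (use assms(2) in auto)

text \<open>
  The product that takes the place of \<open>Q\<close> in the defect.  Its multiplier depends on the parameters
  only through their product, so single parameters can be moved against each other.
\<close>

definition theta4 :: "complex \<Rightarrow> complex \<Rightarrow> complex \<Rightarrow> complex \<Rightarrow> complex \<Rightarrow> complex"
  where "theta4 a b c d x = \<theta> (a * x) * \<theta> (b * x) * \<theta> (c * x) * \<theta> (d * x)"

lemma theta_fun_theta4:
  assumes "a \<noteq> 0" "b \<noteq> 0" "c \<noteq> 0" "d \<noteq> 0"
  shows "theta_fun (1 / (a * b * c * d)) 4 (theta4 a b c d)"
  using theta_fun_mult[OF theta_fun_mult[OF theta_fun_mult[OF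
        theta_fun_theta[OF assms(1)] theta_fun_theta[OF assms(2)]] theta_fun_theta[OF assms(3)]]
      theta_fun_theta[OF assms(4)]]
  by (simp add: theta4_def[abs_def])

text \<open>
  The non-generic values of \<open>e\<close> and \<open>x\<close> are reached by moving along a real curve through them.
  The defect depends continuously on the curve parameter and vanishes off a countable set of
  parameters.
\<close>

theorem defect_theta4:
  assumes prod: "a * b * c * d * e\<^sup>2 = p\<^sup>2" and xz: "x \<noteq> 0" "z \<noteq> 0"
  shows "defect e (theta4 a b c d) x z = 0"
proof -
  have nonzero: "a \<noteq> 0" "b \<noteq> 0" "c \<noteq> 0" "d \<noteq> 0" "e \<noteq> 0"
    using prod nz by auto
  \<comment> \<open>\<open>D\<close> compensates \<open>E\<close> in the product of the parameters; the speeds 1 and 3 are such that none of the four generic quantities stays constant.\<close>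
  define E :: "real \<Rightarrow> complex" where "E = (\<lambda>t. e * exp (of_real t))"
  define X :: "real \<Rightarrow> complex" where "X = (\<lambda>t. x * exp (of_real (3 * t)))"
  define D :: "real \<Rightarrow> complex" where "D = (\<lambda>t. d * exp (of_real (- 2 * t)))"
  define F where "F = (\<lambda>t. defect (E t) (theta4 a b c (D t)) (X t) z)"
  define N where "N = {t. e\<^sup>2 * exp (of_real (2 * t)) \<in> \<Lambda>} \<union> {t. x\<^sup>2 * exp (of_real (6 * t)) \<in> \<Lambda>}
    \<union> {t. (e * x)\<^sup>2 * exp (of_real (8 * t)) \<in> \<Lambda>} \<union> {t. (e / x)\<^sup>2 * exp (of_real (- 4 * t)) \<in> \<Lambda>}"
  have EXD: "E t \<noteq> 0" "X t \<noteq> 0" "D t \<noteq> 0" for t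
    using nonzero xz by (auto simp: E_def X_def D_def)
  have "F t = 0" if t: "t \<in> - N" for t
    unfolding F_def
  proof (rule defect_eq_0_generic)
    have "E t ^ 2 = e\<^sup>2 * exp (of_real (2 * t))"
      by (simp add: E_def power_mult_distrib flip: exp_double)
    moreover have "X t ^ 2 = x\<^sup>2 * exp (of_real (6 * t))"
      by (simp add: X_def power_mult_distrib flip: exp_double)
    moreover have "E t * X t = (e * x) * exp (of_real (4 * t))"
      by (simp add: E_def X_def mult_ac flip: exp_add)
    hence "(E t * X t)\<^sup>2 = (e * x)\<^sup>2 * exp (of_real (8 * t))"
      by (simp add: power_mult_distrib flip: exp_double)
    moreover have "E t / X t = (e / x) * (exp (of_real t) / exp (of_real (3 * t)))"
      by (simp add: E_def X_def)
    hence "E t / X t = (e / x) * exp (of_real (- 2 * t))"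
      by (simp flip: exp_diff)
    hence "(E t / X t)\<^sup>2 = (e / x)\<^sup>2 * exp (of_real (- 4 * t))"
      by (simp add: power_mult_distrib power_divide flip: exp_double)
    ultimately show "(E t)\<^sup>2 \<notin> \<Lambda>" "(X t)\<^sup>2 \<notin> \<Lambda>" "(E t * X t)\<^sup>2 \<notin> \<Lambda>" "(E t / X t)\<^sup>2 \<notin> \<Lambda>"
      using t by (simp_all add: N_def)
    have "D t * (E t)\<^sup>2 = d * e\<^sup>2"
    proof -
      have "exp (of_real (- 2 * t)) * (exp (of_real t))\<^sup>2 = (1 :: complex)"
        by (simp flip: exp_double exp_add)
      thus ?thesis by (simp add: D_def E_def power_mult_distrib mult_ac)
    qed
    hence "a * b * c * D t * (E t)\<^sup>2 = p\<^sup>2"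
      using prod by (simp add: mult.assoc)
    hence "1 / (a * b * c * D t) = (E t)\<^sup>2 / p\<^sup>2"
      using nonzero EXD nz by (simp add: field_simps)
    thus "theta_fun ((E t)\<^sup>2 / p\<^sup>2) 4 (theta4 a b c (D t))"
      using theta_fun_theta4[of a b c "D t"] nonzero EXD by simp
  qed (use EXD xz in auto)
  moreover have "continuous_on UNIV F"
    unfolding F_def defect_def theta4_def
    by (intro continuous_intros continuous_on_theta)
      (use nonzero xz EXD in \<open>auto simp: E_def X_def D_def intro!: continuous_intros\<close>)
  moreover have countable: "countable N"
    unfolding N_def using nonzero xz by (intro countable_Un countable_\<Lambda>_exp) auto
  hence "closure (- N) = UNIV"
  proof -
    have "interior N = {}"
      using open_minus_countable[OF countable _ open_interior[of N]] interior_subset[of N]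
      by blast
    thus ?thesis by (simp add: closure_complement)
  qed
  ultimately have "F 0 = 0"
    using continuous_constant_on_closure[of "- N" F 0 0] by auto
  thus ?thesis by (simp add: F_def E_def X_def D_def)
qed

end

section \<open>Meromorphic functions of two variables as global quotients\<close>

lemma holomorphic2_on_const: "holomorphic2_on (\<lambda>_. c) U"
  unfolding holomorphic2_on_def
  by (intro ballI exI[of _ 0]) (simp add: case_prod_unfold)

lemma holomorphic2_on_fst: "holomorphic2_on fst U"
  unfolding holomorphic2_on_def
  by (intro ballI exI[of _ 1] exI[of _ 0]) (auto intro!: derivative_eq_intros simp: case_prod_unfold)

lemma holomorphic2_on_snd: "holomorphic2_on snd U"
  unfolding holomorphic2_on_def
  by (intro ballI exI[of _ 0] exI[of _ 1]) (auto intro!: derivative_eq_intros simp: case_prod_unfold)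

lemma holomorphic2_on_add:
  assumes "holomorphic2_on f U" "holomorphic2_on g U"
  shows "holomorphic2_on (\<lambda>v. f v + g v) U"
  unfolding holomorphic2_on_def
proof
  fix v assume "v \<in> U"
  then obtain a b c d where
    "(f has_derivative (\<lambda>(u, w). a * u + b * w)) (at v)"
    "(g has_derivative (\<lambda>(u, w). c * u + d * w)) (at v)"
    using assms unfolding holomorphic2_on_def by meson
  hence "((\<lambda>v. f v + g v) has_derivative (\<lambda>(u, w). (a + c) * u + (b + d) * w)) (at v)"
    by (auto intro!: derivative_eq_intros simp: case_prod_unfold algebra_simps)
  thus "\<exists>a b. ((\<lambda>v. f v + g v) has_derivative (\<lambda>(u, w). a * u + b * w)) (at v)" by blast
qed

lemma holomorphic2_on_mult:
  assumes "holomorphic2_on f U" "holomorphic2_on g U"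
  shows "holomorphic2_on (\<lambda>v. f v * g v) U"
  unfolding holomorphic2_on_def
proof
  fix v assume "v \<in> U"
  then obtain a b c d where
    "(f has_derivative (\<lambda>(u, w). a * u + b * w)) (at v)"
    "(g has_derivative (\<lambda>(u, w). c * u + d * w)) (at v)"
    using assms unfolding holomorphic2_on_def by meson
  hence "((\<lambda>v. f v * g v) has_derivative
      (\<lambda>(u, w). (f v * c + a * g v) * u + (f v * d + b * g v) * w)) (at v)"
    by (auto intro!: derivative_eq_intros simp: case_prod_unfold algebra_simps)
  thus "\<exists>a b. ((\<lambda>v. f v * g v) has_derivative (\<lambda>(u, w). a * u + b * w)) (at v)" by blast
qed

lemma holomorphic2_on_compose:
  assumes F: "F holomorphic_on UNIV" and g: "holomorphic2_on g U"
  shows "holomorphic2_on (\<lambda>v. F (g v)) U"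
  unfolding holomorphic2_on_def
proof
  fix v assume "v \<in> U"
  then obtain a b where
    "(g has_derivative (\<lambda>(u, w). a * u + b * w)) (at v)"
    using g unfolding holomorphic2_on_def by meson
  moreover have "(F has_derivative (*) (deriv F (g v))) (at (g v))"
    using holomorphic_derivI[OF F open_UNIV] by (simp add: has_field_derivative_def)
  ultimately have "((\<lambda>v. F (g v)) has_derivative
      (\<lambda>x. deriv F (g v) * (case x of (u, w) \<Rightarrow> a * u + b * w))) (at v)"
    by (rule has_derivative_compose)
  hence "((\<lambda>v. F (g v)) has_derivative
      (\<lambda>(u, w). (deriv F (g v) * a) * u + (deriv F (g v) * b) * w)) (at v)"
    by (simp add: case_prod_unfold algebra_simps)
  thus "\<exists>a b. ((\<lambda>v. F (g v)) has_derivative (\<lambda>(u, w). a * u + b * w)) (at v)" by blast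
qed

lemma holomorphic2_on_imp_continuous_on:
  assumes "holomorphic2_on f U"
  shows "continuous_on U f"
  using assms unfolding holomorphic2_on_def
  by (meson continuous_at_imp_continuous_on has_derivative_continuous)

lemma holomorphic2_on_diff:
  assumes "holomorphic2_on f U" "holomorphic2_on g U"
  shows "holomorphic2_on (\<lambda>v. f v - g v) U"
  using holomorphic2_on_add[OF assms(1) holomorphic2_on_mult[OF holomorphic2_on_const[of "- 1"] assms(2)]]
  by simp

lemmas holomorphic2_intros =
  holomorphic2_on_const holomorphic2_on_fst holomorphic2_on_snd
  holomorphic2_on_add holomorphic2_on_mult holomorphic2_on_diff

lemma holomorphic2_on_qpow:
  assumes "holomorphic2_on g U"
  shows "holomorphic2_on (\<lambda>v. qpow \<tau> (g v)) U"
proof (rule holomorphic2_on_compose[OF _ assms])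
  show "qpow \<tau> holomorphic_on UNIV"
    unfolding qpow_def[abs_def] by (intro holomorphic_intros)
qed

definition denominator :: "(complex \<times> complex \<Rightarrow> complex) \<Rightarrow> bool"
  where "denominator h \<longleftrightarrow>
    holomorphic2_on h UNIV \<and> (\<forall>V. open V \<and> V \<noteq> {} \<longrightarrow> (\<exists>v\<in>V. h v \<noteq> 0))"

text \<open>
  The nonvanishing loci are open and dense, and the intersection of two such sets is dense.
\<close>

lemma denominator_mult:
  assumes f: "denominator f" and g: "denominator g"
  shows "denominator (\<lambda>v. f v * g v)"
  unfolding denominator_def
proof (intro conjI allI impI)
  show "holomorphic2_on (\<lambda>v. f v * g v) UNIV"
    using assms by (auto simp: denominator_def intro: holomorphic2_on_mult)
  fix V :: "(complex \<times> complex) set"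
  assume V: "open V \<and> V \<noteq> {}"
  have "open (V \<inter> f -` (- {0}))"
    using V f holomorphic2_on_imp_continuous_on[of f UNIV]
    by (auto simp: denominator_def intro!: open_Int open_vimage)
  moreover have "V \<inter> f -` (- {0}) \<noteq> {}"
    using V f unfolding denominator_def by blast
  ultimately obtain v where "v \<in> V \<inter> f -` (- {0})" "g v \<noteq> 0"
    using g unfolding denominator_def by meson
  thus "\<exists>v\<in>V. f v * g v \<noteq> 0" by auto
qed

lemma denominator_nonzero:
  assumes "holomorphic2_on h UNIV" "\<And>v. h v \<noteq> 0"
  shows "denominator h"
  using assms by (auto simp: denominator_def)

lemma denominator_zeros_nowhere_dense:
  assumes "denominator h"
  shows "interior (closure {v. h v = 0}) = {}"
proof -
  have "closed {v. h v = 0}"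
    using assms holomorphic2_on_imp_continuous_on[of h UNIV]
    by (intro closed_Collect_eq) (auto simp: denominator_def)
  moreover have "interior {v. h v = 0} = {}"
  proof (rule ccontr)
    assume "interior {v. h v = 0} \<noteq> {}"
    then obtain v where "v \<in> interior {v. h v = 0}" "h v \<noteq> 0"
      using assms unfolding denominator_def by (meson open_interior)
    thus False using interior_subset by blast
  qed
  ultimately show ?thesis by simp
qed

text \<open>
  A meromorphic function on \<open>\<complex>\<^sup>2\<close> that is given by a single fraction.  In contrast to the
  local notion, two such fractions are added and multiplied without patching.
\<close>

definition global_quotient :: "(complex \<times> complex \<Rightarrow> complex) \<Rightarrow> bool"
  where "global_quotient f \<longleftrightarrow> (\<exists>g h. holomorphic2_on g UNIV \<and> denominator h \<and>
    (\<forall>v. h v \<noteq> 0 \<longrightarrow> f v = g v / h v))"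

lemma global_quotient_add:
  assumes "global_quotient f" "global_quotient g"
  shows "global_quotient (\<lambda>v. f v + g v)"
proof -
  obtain f1 f2 g1 g2 where *: "holomorphic2_on f1 UNIV" "denominator f2" "holomorphic2_on g1 UNIV" "denominator g2"
    "\<And>v. f2 v \<noteq> 0 \<Longrightarrow> f v = f1 v / f2 v" "\<And>v. g2 v \<noteq> 0 \<Longrightarrow> g v = g1 v / g2 v"
    using assms unfolding global_quotient_def by metis
  have "holomorphic2_on (\<lambda>v. f1 v * g2 v + g1 v * f2 v) UNIV"
    using * by (intro holomorphic2_intros) (auto simp: denominator_def)
  moreover have "f v + g v = (f1 v * g2 v + g1 v * f2 v) / (f2 v * g2 v)" if "f2 v * g2 v \<noteq> 0" for v
    using that *(5,6)[of v] by (simp add: field_simps)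
  ultimately show ?thesis
    unfolding global_quotient_def using denominator_mult[OF *(2,4)] by blast
qed

lemma global_quotient_mult:
  assumes "global_quotient f" "global_quotient g"
  shows "global_quotient (\<lambda>v. f v * g v)"
proof -
  obtain f1 f2 g1 g2 where *: "holomorphic2_on f1 UNIV" "denominator f2" "holomorphic2_on g1 UNIV" "denominator g2"
    "\<And>v. f2 v \<noteq> 0 \<Longrightarrow> f v = f1 v / f2 v" "\<And>v. g2 v \<noteq> 0 \<Longrightarrow> g v = g1 v / g2 v"
    using assms unfolding global_quotient_def by metis
  have "f v * g v = (f1 v * g1 v) / (f2 v * g2 v)" if "f2 v * g2 v \<noteq> 0" for v
    using that *(5,6)[of v] by simp
  thus ?thesis
    unfolding global_quotient_def using denominator_mult[OF *(2,4)] holomorphic2_on_mult[OF *(1,3)] by blast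
qed

lemma global_quotient_imp_meromorphic2:
  assumes "global_quotient f"
  shows "meromorphic2 f"
proof -
  obtain g h where "holomorphic2_on g UNIV" "denominator h" "\<And>v. h v \<noteq> 0 \<Longrightarrow> f v = g v / h v"
    using assms unfolding global_quotient_def by blast
  thus ?thesis
    unfolding meromorphic2_def denominator_def
    by (intro allI exI[of _ UNIV] exI[of _ g] exI[of _ h]) auto
qed

text \<open>
  Points where some denominator vanishes form a nowhere dense set and may be ignored; in
  applications \<open>h\<close> collects all denominators.
\<close>

lemma eq_meromorphic2I:
  assumes "global_quotient f" "global_quotient g" "denominator h" and eq: "\<And>v. h v \<noteq> 0 \<Longrightarrow> f v = g v"
  shows "eq_meromorphic2 f g"
proof -
  have "interior (closure {v. f v \<noteq> g v}) \<subseteq> interior (closure {v. h v = 0})"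
    using eq by (intro interior_mono closure_mono) blast
  thus ?thesis
    using assms global_quotient_imp_meromorphic2 denominator_zeros_nowhere_dense by (simp add: eq_meromorphic2_def)
qed

lemma qpow_add: "qpow \<tau> (x + y) = qpow \<tau> x * qpow \<tau> y"
  by (simp add: qpow_def ring_distribs exp_add)

lemma qpow_minus: "qpow \<tau> (- x) = 1 / qpow \<tau> x"
  by (simp add: qpow_def exp_minus field_simps)

lemma qpow_diff: "qpow \<tau> (x - y) = qpow \<tau> x / qpow \<tau> y"
  by (simp add: qpow_def right_diff_distrib exp_diff)

lemma qpow_nz: "qpow \<tau> x \<noteq> 0"
  by (simp add: qpow_def)

context nome
begin

lemma holomorphic2_on_theta:
  assumes "holomorphic2_on g U" "t \<noteq> 0"
  shows "holomorphic2_on (\<lambda>v. \<theta> (t * qpow \<tau> (g v))) U"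
proof (rule holomorphic2_on_compose[OF _ assms(1)])
  have "qpow \<tau> holomorphic_on UNIV"
    unfolding qpow_def[abs_def] by (intro holomorphic_intros)
  thus "(\<lambda>w. \<theta> (t * qpow \<tau> w)) holomorphic_on UNIV"
    using assms qpow_nz by (intro holomorphic_theta_compose holomorphic_intros) auto
qed

text \<open>
  In the direction in which the exponent grows by a real parameter, the argument of \<open>\<theta>\<close> runs
  through a ray and meets the lattice of zeros in countably many points only, so every
  nonempty open set contains points where \<open>\<theta>\<close> is nonzero.
\<close>

lemma denominator_theta:
  assumes "t \<noteq> 0" "\<tau> \<noteq> 0" "\<alpha> \<noteq> 0 \<or> \<beta> \<noteq> 0"
  shows "denominator (\<lambda>v. \<theta> (t * qpow \<tau> (\<alpha> * fst v + \<beta> * snd v)))"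
  unfolding denominator_def
proof (intro conjI allI impI)
  show "holomorphic2_on (\<lambda>v. \<theta> (t * qpow \<tau> (\<alpha> * fst v + \<beta> * snd v))) UNIV"
    using assms by (intro holomorphic2_on_theta holomorphic2_intros)
  fix V :: "(complex \<times> complex) set"
  assume V: "open V \<and> V \<noteq> {}"
  then obtain x z where xz: "(x, z) \<in> V" by auto
  define k where "k = 2 * of_real pi * \<i> * \<tau>"
  have k: "k \<noteq> 0" using assms by (simp add: k_def)
  obtain \<xi> \<zeta> where dir: "\<alpha> * \<xi> + \<beta> * \<zeta> = 1 / k"
  proof (cases "\<alpha> = 0")
    case True thus ?thesis using assms that[of 0 "1 / (k * \<beta>)"] by simp
  next
    case False thus ?thesis using that[of "1 / (k * \<alpha>)" 0] by simp
  qed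
  define l where "l = (\<lambda>r::real. (x + of_real r * \<xi>, z + of_real r * \<zeta>))"
  define u where "u = t * qpow \<tau> (\<alpha> * x + \<beta> * z)"
  have u: "u \<noteq> 0" using assms qpow_nz by (simp add: u_def)
  have val: "t * qpow \<tau> (\<alpha> * fst (l r) + \<beta> * snd (l r)) = u * exp (of_real (1 * r))" for r
  proof -
    have "\<alpha> * fst (l r) + \<beta> * snd (l r) = (\<alpha> * x + \<beta> * z) + of_real r * (\<alpha> * \<xi> + \<beta> * \<zeta>)"
      by (simp add: l_def algebra_simps)
    moreover have "qpow \<tau> (of_real r * (1 / k)) = exp (of_real r)"
      using k by (simp add: qpow_def k_def[symmetric])
    ultimately show ?thesis by (simp add: u_def qpow_add dir mult.assoc)
  qed
  have "continuous_on UNIV l"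
    unfolding l_def by (intro continuous_intros)
  hence "open (l -` V)"
    using V by (intro open_vimage) auto
  moreover have "0 \<in> l -` V" using xz by (simp add: l_def)
  ultimately obtain r where "r \<in> l -` V" "u * exp (of_real (1 * r)) \<notin> \<Lambda>"
    using open_minus_countable[OF countable_\<Lambda>_exp[OF u, of 1], of "l -` V"] by auto
  hence "l r \<in> V" "\<theta> (t * qpow \<tau> (\<alpha> * fst (l r) + \<beta> * snd (l r))) \<noteq> 0"
    using u theta_eq_0_iff[of "u * exp (of_real (1 * r))"] unfolding val by auto
  thus "\<exists>v\<in>V. \<theta> (t * qpow \<tau> (\<alpha> * fst v + \<beta> * snd v)) \<noteq> 0" by blast
qed

section \<open>The identity for the c-function\<close>

text \<open>
  This is the vanishing of the defect for \<open>theta4\<close> with parameters \<open>a, b, c, p/d\<close>.  By the reflection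
  \<open>\<theta>(p/u) = \<theta>(u)\<close> its value at \<open>y\<close> has the factor \<open>\<theta>(d/y)\<close>, and the relations turn its value
  at \<open>e y\<close> into the same kind of product for the dual parameters at \<open>1/y\<close>.
\<close>

lemma theta_products_identity:
  assumes xz: "x \<noteq> 0" "z \<noteq> 0"
    and nonzero: "a' \<noteq> 0" "b' \<noteq> 0" "c' \<noteq> 0" "d \<noteq> 0"
    and rel: "d = e * a'" "d' = e * a" "b * e = p / c'" "c * e = p / b'"
      "a * b * c * (p / d) * e\<^sup>2 = p\<^sup>2"
  shows "\<theta> (z\<^sup>2) *
      (\<theta> (e * x / z) * \<theta> (e * x * z) * (\<theta> (a * x) * \<theta> (b * x) * \<theta> (c * x)) * \<theta> (d / x)
       - x\<^sup>2 * \<theta> (e / x / z) * \<theta> (e / x * z) * (\<theta> (a / x) * \<theta> (b / x) * \<theta> (c / x)) * \<theta> (d * x))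
    = \<theta> (x\<^sup>2) *
      (\<theta> (e / x * z) * \<theta> (e * x * z) * (\<theta> (a' * z) * \<theta> (b' * z) * \<theta> (c' * z)) * \<theta> (d' / z)
       - z\<^sup>2 * \<theta> (e * x / z) * \<theta> (e / x / z) * (\<theta> (a' / z) * \<theta> (b' / z) * \<theta> (c' / z)) * \<theta> (d' * z))"
proof -
  have e: "e \<noteq> 0" using nonzero rel by auto
  have flip: "\<theta> (p / u * v) = \<theta> (u / v)" for u v
    using theta_reflect[of "u / v"] by simp
  have e_d: "p / d * e = p / a'"
    using e by (simp add: rel(1))
  have Q_x: "theta4 a b c (p / d) y = \<theta> (a * y) * \<theta> (b * y) * \<theta> (c * y) * \<theta> (d / y)" for y
    by (simp only: theta4_def flip)
  have Q_ez: "theta4 a b c (p / d) (e * y) = \<theta> (a' / y) * \<theta> (b' / y) * \<theta> (c' / y) * \<theta> (d' * y)" for y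
  proof -
    have "theta4 a b c (p / d) (e * y) = \<theta> (d' * y) * \<theta> (b * e * y) * \<theta> (c * e * y) * \<theta> (p / d * e * y)"
      by (simp only: theta4_def rel(2) mult_ac)
    thus ?thesis by (simp only: rel(3,4) e_d flip) (simp only: mult_ac)
  qed
  show ?thesis
    using defect_theta4[OF rel(5) xz] Q_x[of x] Q_x[of "1 / x"] Q_ez[of z] Q_ez[of "1 / z"]
    by (simp add: defect_def mult.assoc)
qed

end

lemma nome_qpow:
  assumes "Im \<tau> > 0" "s > 0"
  shows "nome (qpow \<tau> (of_real s))"
proof
  show "norm (qpow \<tau> (of_real s)) < 1"
    using assms by (simp add: qpow_def)
qed (rule qpow_nz)

lemma global_quotient_c_fun:
  assumes \<tau>: "Im \<tau> > 0" and s: "s > 0" and lin: "\<alpha> \<noteq> 0 \<or> \<beta> \<noteq> 0" "\<gamma> \<noteq> 0 \<or> \<delta> \<noteq> 0"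
  shows "global_quotient (\<lambda>v. c_fun \<tau> s \<kappa> lam \<upsilon> \<sigma> (\<alpha> * fst v + \<beta> * snd v) (\<gamma> * fst v + \<delta> * snd v))"
proof -
  define p where "p = qpow \<tau> (of_real s)"
  interpret nome p unfolding p_def using \<tau> s by (rule nome_qpow)
  define d where "d = AW_d \<tau> s \<kappa> lam \<upsilon> \<sigma>"
  define a' where "a' = AW_a \<tau> s \<kappa> \<upsilon> lam \<sigma>"
  define b' where "b' = AW_b \<tau> s \<kappa> \<upsilon> lam \<sigma>"
  define c' where "c' = AW_c \<tau> s \<kappa> \<upsilon> lam \<sigma>"
  have nonzero: "d \<noteq> 0" "a' \<noteq> 0" "b' \<noteq> 0" "c' \<noteq> 0"
    by (simp_all add: d_def a'_def b'_def c'_def AW_a_def AW_b_def AW_c_def AW_d_def qpow_nz)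
  have "\<tau> \<noteq> 0" using \<tau> by auto
  define x :: "complex \<times> complex \<Rightarrow> complex" where "x = (\<lambda>v. \<alpha> * fst v + \<beta> * snd v)"
  define z :: "complex \<times> complex \<Rightarrow> complex" where "z = (\<lambda>v. \<gamma> * fst v + \<delta> * snd v)"
  have x: "holomorphic2_on x UNIV" and z: "holomorphic2_on z UNIV"
    unfolding x_def z_def by (intro holomorphic2_intros)+
  have minus_z: "holomorphic2_on (\<lambda>v. - z v) UNIV" and x_minus_z: "holomorphic2_on (\<lambda>v. x v - z v) UNIV"
    using holomorphic2_on_diff[OF holomorphic2_on_const[of 0] z] holomorphic2_on_diff[OF x z] by simp_all
  define g where "g = (\<lambda>v. \<theta> (a' * qpow \<tau> (- z v)) * \<theta> (b' * qpow \<tau> (- z v)) * \<theta> (c' * qpow \<tau> (- z v))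
      * \<theta> (d / a' * qpow \<tau> (x v - z v)))"
  define h where "h = (\<lambda>v. gauge_W \<tau> s \<kappa> lam \<upsilon> \<sigma> (x v) (z v)
      * (\<theta> (1 * qpow \<tau> ((- 2 * \<gamma>) * fst v + (- 2 * \<delta>) * snd v)) * \<theta> (d * qpow \<tau> (\<alpha> * fst v + \<beta> * snd v))))"
  have "holomorphic2_on g UNIV"
    unfolding g_def using nonzero
    by (intro holomorphic2_on_mult holomorphic2_on_theta minus_z x_minus_z) auto
  moreover have "denominator h"
    unfolding h_def
  proof (intro denominator_mult denominator_theta denominator_nonzero)
    have "holomorphic2_on (\<lambda>v. (of_real \<kappa> + of_real lam + x v) * (of_real \<kappa> + of_real \<upsilon> + z v)
        * (1 / of_real s)) UNIV"
      by (intro holomorphic2_intros x z)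
    thus "holomorphic2_on (\<lambda>v. gauge_W \<tau> s \<kappa> lam \<upsilon> \<sigma> (x v) (z v)) UNIV"
      unfolding gauge_W_def by (intro holomorphic2_on_qpow) simp
  qed (use lin nonzero \<open>\<tau> \<noteq> 0\<close> in \<open>auto simp: gauge_W_def qpow_nz\<close>)
  moreover have "c_fun \<tau> s \<kappa> lam \<upsilon> \<sigma> (x v) (z v) = g v / h v" for v
  proof -
    have "- 2 * z v = (- 2 * \<gamma>) * fst v + (- 2 * \<delta>) * snd v"
      by (simp add: z_def algebra_simps)
    thus ?thesis
      by (simp only: c_fun_def Let_def thetas_def g_def h_def flip: p_def d_def a'_def b'_def c'_def)
        (simp add: x_def mult.assoc)
  qed
  ultimately show ?thesis
    unfolding global_quotient_def x_def z_def by blast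
qed

text \<open>
  The four products of c-functions differ from the four terms of the theta identity by one common
  factor \<open>K\<close>.  Here \<open>u1, ..., u4\<close> stand for the theta factors with parameter \<open>e\<close>; \<open>P\<close> and \<open>Q\<close> for the
  products over three parameters in \<open>Z\<close> and \<open>X\<close>, with \<open>p\<close> and \<open>m\<close> for the sign of the exponent; \<open>D\<close>
  and \<open>E\<close> for the factors with parameters \<open>d\<close> and \<open>d'\<close>; \<open>S\<close> and \<open>T\<close> for \<open>\<theta>(X\<^sup>2)\<close> and \<open>\<theta>(Z\<^sup>2)\<close>; and
  \<open>W1, W2, W3\<close> for the gauge factors.
\<close>

lemma c_function_algebra:
  fixes T S D1 D2 E1 E2 W1 W2 W3 X Z :: "'a :: field"
  assumes nz: "T \<noteq> 0" "S \<noteq> 0" "D1 \<noteq> 0" "D2 \<noteq> 0" "E1 \<noteq> 0" "E2 \<noteq> 0" "W1 \<noteq> 0" "W2 \<noteq> 0" "W3 \<noteq> 0"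
      "X \<noteq> 0" "Z \<noteq> 0"
    and eq: "T * (u1 * u2 * Qp * D2 - X\<^sup>2 * u3 * u4 * Qm * D1)
      = S * (u4 * u2 * Pp * E2 - Z\<^sup>2 * u1 * u3 * Pm * E1)"
  shows "Pm * u1 / (W1 * ((- T / Z\<^sup>2) * D1)) * (Qp * u2 / (W2 * (S * E1))) * (Qp * u1 / (W3 * (S * E2)))
       + Pm * u3 / (W2 * ((- T / Z\<^sup>2) * D2)) * (Qm * u4 / (W1 * ((- S / X\<^sup>2) * E1))) * (Qp * u1 / (W3 * (S * E2)))
       = Pm * u1 / (W1 * ((- T / Z\<^sup>2) * D1)) * (Pm * u3 / (W2 * ((- T / Z\<^sup>2) * D2))) * (Qp * u1 / (W3 * (S * E2)))
       + Pm * u1 / (W1 * ((- T / Z\<^sup>2) * D1)) * (Pp * u4 / (W3 * (T * D2))) * (Qp * u2 / (W2 * (S * E1)))"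
    (is "?t1 + ?t2 = ?t3 + ?t4")
proof -
  define K where "K = - Z\<^sup>2 * Pm * Qp * u1 / (W1 * W2 * W3 * T\<^sup>2 * S\<^sup>2 * D1 * D2 * E1 * E2)"
  have "?t1 = K * (T * (u1 * u2 * Qp * D2))" "?t2 = - (K * (T * (X\<^sup>2 * u3 * u4 * Qm * D1)))"
    "?t3 = - (K * (S * (Z\<^sup>2 * u1 * u3 * Pm * E1)))" "?t4 = K * (S * (u4 * u2 * Pp * E2))"
    using nz by (simp_all add: K_def divide_simps power2_eq_square)
  moreover have "K * (T * (u1 * u2 * Qp * D2)) - K * (T * (X\<^sup>2 * u3 * u4 * Qm * D1))
      = K * (S * (u4 * u2 * Pp * E2)) - K * (S * (Z\<^sup>2 * u1 * u3 * Pm * E1))"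
    using arg_cong[OF eq, of "\<lambda>t. K * t"] by (simp only: right_diff_distrib)
  ultimately show ?thesis by simp
qed

text \<open>
  With \<open>e = d/a' = d'/a\<close> the Askey--Wilson parameters satisfy the relations of the theta identity.
  Exchanging \<open>\<lambda>\<close> and \<open>\<upsilon>\<close> in the gauge factor amounts to exchanging its arguments, so the six values
  of \<open>c\<close> and \<open>c\<^sup>d\<close> involve only three gauge factors, and these cancel.
\<close>

lemma c_function_identity:
  fixes \<tau> x z :: complex and s \<kappa> lam \<upsilon> \<sigma> :: real
  assumes \<tau>: "Im \<tau> > 0" and s: "s > 0"
  defines "c \<equiv> c_fun \<tau> s \<kappa> lam \<upsilon> \<sigma>" and "cd \<equiv> cd_fun \<tau> s \<kappa> lam \<upsilon> \<sigma>"
    and "p \<equiv> qpow \<tau> (of_real s)"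
    and "d \<equiv> AW_d \<tau> s \<kappa> lam \<upsilon> \<sigma>" and "d' \<equiv> AW_d \<tau> s \<kappa> \<upsilon> lam \<sigma>"
  assumes nonzero: "theta (qpow \<tau> (2 * x)) p \<noteq> 0" "theta (qpow \<tau> (2 * z)) p \<noteq> 0"
    "theta (d * qpow \<tau> x) p \<noteq> 0" "theta (d * qpow \<tau> (- x)) p \<noteq> 0"
    "theta (d' * qpow \<tau> z) p \<noteq> 0" "theta (d' * qpow \<tau> (- z)) p \<noteq> 0"
  shows "c x z * cd z (- x) * cd (- z) (- x) + c (- x) z * cd z x * cd (- z) (- x)
    = c x z * c (- x) z * cd (- z) (- x) + c x z * c (- x) (- z) * cd z (- x)"
proof -
  interpret nome p unfolding p_def using \<tau> s by (rule nome_qpow)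
  define X where "X = qpow \<tau> x"
  define Z where "Z = qpow \<tau> z"
  have XZ: "X \<noteq> 0" "Z \<noteq> 0" by (simp_all add: X_def Z_def qpow_nz)
  define a where "a = AW_a \<tau> s \<kappa> lam \<upsilon> \<sigma>"
  define b where "b = AW_b \<tau> s \<kappa> lam \<upsilon> \<sigma>"
  define c0 where "c0 = AW_c \<tau> s \<kappa> lam \<upsilon> \<sigma>"
  define a' where "a' = AW_a \<tau> s \<kappa> \<upsilon> lam \<sigma>"
  define b' where "b' = AW_b \<tau> s \<kappa> \<upsilon> lam \<sigma>"
  define c' where "c' = AW_c \<tau> s \<kappa> \<upsilon> lam \<sigma>"
  define e where "e = - qpow \<tau> (of_real (s / 2 - \<sigma> - \<kappa>))"
  have params: "a' \<noteq> 0" "b' \<noteq> 0" "c' \<noteq> 0" "d \<noteq> 0" "a \<noteq> 0"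
    by (simp_all add: a'_def b'_def c'_def d_def a_def AW_a_def AW_b_def AW_c_def AW_d_def qpow_nz)
  note AW = a_def b_def c0_def d_def a'_def b'_def c'_def d'_def e_def p_def
    AW_a_def AW_b_def AW_c_def AW_d_def
  have rel: "d = e * a'" "d' = e * a" "b * e = p / c'" "c0 * e = p / b'"
    unfolding AW by (simp_all add: field_simps qpow_nz flip: qpow_add)
  have "a * b * c0 * p * e\<^sup>2 = p\<^sup>2 * d"
    unfolding AW
    by (simp add: power2_eq_square flip: qpow_add)
  hence "a * b * c0 * (p / d) * e\<^sup>2 = p\<^sup>2"
    using params by (simp add: field_simps)
  note rel = rel this
  note main = theta_products_identity[OF XZ params(1-4) rel]
  have sq: "qpow \<tau> (2 * y) = (qpow \<tau> y)\<^sup>2" for y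
    using qpow_add[of \<tau> y y] by (simp add: power2_eq_square)
  define W where "W = (\<lambda>y w. gauge_W \<tau> s \<kappa> lam \<upsilon> \<sigma> y w)"
  have W: "W y w \<noteq> 0" for y w by (simp add: W_def gauge_W_def qpow_nz)
  have quot: "d / a' = e" "d' / a = e"
    using params rel by simp_all
  have W_dual: "gauge_W \<tau> s \<kappa> \<upsilon> lam \<sigma> w y = W y w" for y w
    by (simp add: W_def gauge_W_def mult.commute)
  have c_eq: "c y w = (\<theta> (a' * qpow \<tau> (- w)) * \<theta> (b' * qpow \<tau> (- w)) * \<theta> (c' * qpow \<tau> (- w)))
      * \<theta> (e * qpow \<tau> (y - w)) / (W y w * (\<theta> (qpow \<tau> (2 * (- w))) * \<theta> (d * qpow \<tau> y)))" for y w
  proof -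
    have "d * qpow \<tau> (y - w) / a' = e * qpow \<tau> (y - w)"
      using quot(1) by (metis times_divide_eq_left)
    thus ?thesis
      by (simp add: c_def c_fun_def Let_def thetas_def W_def mult.assoc
          flip: p_def d_def a'_def b'_def c'_def)
  qed
  have cd_eq: "cd w y = (\<theta> (a * qpow \<tau> (- y)) * \<theta> (b * qpow \<tau> (- y)) * \<theta> (c0 * qpow \<tau> (- y)))
      * \<theta> (e * qpow \<tau> (w - y)) / (W y w * (\<theta> (qpow \<tau> (2 * (- y))) * \<theta> (d' * qpow \<tau> w)))" for y w
  proof -
    have "d' * qpow \<tau> (w - y) / a = e * qpow \<tau> (w - y)"
      using quot(2) by (metis times_divide_eq_left)
    thus ?thesis
      by (simp add: cd_def cd_fun_def c_fun_def Let_def thetas_def W_dual mult.assoc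
          flip: p_def d'_def a_def b_def c0_def)
  qed
  have theta_sq_inv: "\<theta> (qpow \<tau> (2 * (- y))) = - \<theta> ((qpow \<tau> y)\<^sup>2) / (qpow \<tau> y)\<^sup>2" for y
    using theta_inverse[of "(qpow \<tau> y)\<^sup>2"] qpow_nz[of \<tau> y]
    by (simp only: sq qpow_minus) (simp add: power_divide)
  define Pm where "Pm = \<theta> (a' / Z) * \<theta> (b' / Z) * \<theta> (c' / Z)"
  define Pp where "Pp = \<theta> (a' * Z) * \<theta> (b' * Z) * \<theta> (c' * Z)"
  define Qm where "Qm = \<theta> (a / X) * \<theta> (b / X) * \<theta> (c0 / X)"
  define Qp where "Qp = \<theta> (a * X) * \<theta> (b * X) * \<theta> (c0 * X)"
  have c_vals:
    "c x z = Pm * \<theta> (e * X / Z) / (W x z * ((- \<theta> (Z\<^sup>2) / Z\<^sup>2) * \<theta> (d * X)))"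
    "c (- x) z = Pm * \<theta> (e / X / Z) / (W (- x) z * ((- \<theta> (Z\<^sup>2) / Z\<^sup>2) * \<theta> (d / X)))"
    "c (- x) (- z) = Pp * \<theta> (e / X * Z) / (W (- x) (- z) * (\<theta> (Z\<^sup>2) * \<theta> (d / X)))"
    "cd z (- x) = Qp * \<theta> (e * X * Z) / (W (- x) z * (\<theta> (X\<^sup>2) * \<theta> (d' * Z)))"
    "cd (- z) (- x) = Qp * \<theta> (e * X / Z) / (W (- x) (- z) * (\<theta> (X\<^sup>2) * \<theta> (d' / Z)))"
    "cd z x = Qm * \<theta> (e / X * Z) / (W x z * ((- \<theta> (X\<^sup>2) / X\<^sup>2) * \<theta> (d' * Z)))"
    unfolding c_eq cd_eq theta_sq_inv minus_minus unfolding sq Pm_def Pp_def Qm_def Qp_def X_def Z_def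
    by (simp_all add: qpow_minus qpow_diff qpow_add mult_ac)
  have nz: "\<theta> (Z\<^sup>2) \<noteq> 0" "\<theta> (X\<^sup>2) \<noteq> 0" "\<theta> (d * X) \<noteq> 0" "\<theta> (d / X) \<noteq> 0"
    "\<theta> (d' * Z) \<noteq> 0" "\<theta> (d' / Z) \<noteq> 0"
    using nonzero by (simp_all add: sq qpow_minus X_def Z_def)
  show ?thesis
    unfolding c_vals
    by (rule c_function_algebra[OF nz W W W XZ main[folded Pm_def Pp_def Qm_def Qp_def]])
qed

theorem corollary2p8:
  fixes \<tau> :: complex and s \<kappa> lam \<upsilon> \<sigma> :: real
  assumes "Re \<tau> = 0" and "Im \<tau> > 0"
    and "s \<in> \<rat>" and "s > 0"
  defines "c \<equiv> c_fun \<tau> s \<kappa> lam \<upsilon> \<sigma>"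
    and "cd \<equiv> cd_fun \<tau> s \<kappa> lam \<upsilon> \<sigma>"
  shows "eq_meromorphic2
    (\<lambda>(x, z). c x z * cd z (- x) * cd (- z) (- x) + c (- x) z * cd z x * cd (- z) (- x))
    (\<lambda>(x, z). c x z * c (- x) z * cd (- z) (- x) + c x z * c (- x) (- z) * cd z (- x))"
proof -
  define p where "p = qpow \<tau> (of_real s)"
  interpret nome p unfolding p_def using assms(2,4) by (rule nome_qpow)
  have "\<tau> \<noteq> 0" using assms(2) by auto
  define d where "d = AW_d \<tau> s \<kappa> lam \<upsilon> \<sigma>"
  define d' where "d' = AW_d \<tau> s \<kappa> \<upsilon> lam \<sigma>"
  have d: "d \<noteq> 0" "d' \<noteq> 0" by (simp_all add: d_def d'_def AW_d_def qpow_nz)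
  define lin :: "complex \<Rightarrow> complex \<Rightarrow> complex \<times> complex \<Rightarrow> complex"
    where "lin = (\<lambda>\<alpha> \<beta> v. \<alpha> * fst v + \<beta> * snd v)"
  \<comment> \<open>All theta factors in the denominators, up to units, as \<open>\<theta>(u\<^sup>-\<^sup>2)\<close> is a unit times \<open>\<theta>(u\<^sup>2)\<close>.\<close>
  define h where "h = (\<lambda>v. \<theta> (1 * qpow \<tau> (lin 2 0 v)) * \<theta> (1 * qpow \<tau> (lin 0 2 v))
      * \<theta> (d * qpow \<tau> (lin 1 0 v)) * \<theta> (d * qpow \<tau> (lin (- 1) 0 v))
      * \<theta> (d' * qpow \<tau> (lin 0 1 v)) * \<theta> (d' * qpow \<tau> (lin 0 (- 1) v)))"
  have reg: "denominator h"
    unfolding h_def lin_def using d \<open>\<tau> \<noteq> 0\<close> by (intro denominator_mult denominator_theta) auto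
  have frac_c: "global_quotient (\<lambda>v. c (lin \<alpha> \<beta> v) (lin \<gamma> \<delta> v))" "global_quotient (\<lambda>v. cd (lin \<alpha> \<beta> v) (lin \<gamma> \<delta> v))"
    if "\<alpha> \<noteq> 0 \<or> \<beta> \<noteq> 0" "\<gamma> \<noteq> 0 \<or> \<delta> \<noteq> 0" for \<alpha> \<beta> \<gamma> \<delta>
    unfolding c_def cd_def cd_fun_def lin_def using assms(2,4) that by (intro global_quotient_c_fun; simp)+
  have lin: "lin 1 0 v = fst v" "lin 0 1 v = snd v" "lin (- 1) 0 v = - fst v" "lin 0 (- 1) v = - snd v"
    "lin 2 0 v = 2 * fst v" "lin 0 2 v = 2 * snd v" for v
    by (simp_all add: lin_def)
  have fracs: "global_quotient (\<lambda>v. c (fst v) (snd v))" "global_quotient (\<lambda>v. c (- fst v) (snd v))"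
    "global_quotient (\<lambda>v. c (- fst v) (- snd v))" "global_quotient (\<lambda>v. cd (snd v) (- fst v))"
    "global_quotient (\<lambda>v. cd (- snd v) (- fst v))" "global_quotient (\<lambda>v. cd (snd v) (fst v))"
    using frac_c(1)[of 1 0 0 1] frac_c(1)[of "- 1" 0 0 1] frac_c(1)[of "- 1" 0 0 "- 1"]
      frac_c(2)[of 0 1 "- 1" 0] frac_c(2)[of 0 "- 1" "- 1" 0] frac_c(2)[of 0 1 1 0]
    by (simp_all add: lin)
  show ?thesis
    unfolding case_prod_unfold
  proof (rule eq_meromorphic2I[OF _ _ reg])
    fix v assume "h v \<noteq> 0"
    thus "c (fst v) (snd v) * cd (snd v) (- fst v) * cd (- snd v) (- fst v)
        + c (- fst v) (snd v) * cd (snd v) (fst v) * cd (- snd v) (- fst v)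
      = c (fst v) (snd v) * c (- fst v) (snd v) * cd (- snd v) (- fst v)
        + c (fst v) (snd v) * c (- fst v) (- snd v) * cd (snd v) (- fst v)"
      unfolding c_def cd_def using assms(2,4)
      by (intro c_function_identity) (auto simp: h_def lin d_def d'_def p_def)
  qed (intro global_quotient_add global_quotient_mult fracs)+
qed

end
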